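(* Let $V$ be a finite-dimensional vector space over a field $K$, let $f : V \to V$ be a nilpotent $K$-linear map, and let $s^{t_1}, \dots, s^{t_k}$, with $0 < t_1 \le \cdots \le t_k$, be the elementary divisors of $f$. Let $U = (u_1,\dots,u_k) \in \mathcal{U}$ be a generator tuple of $V$ and let $r = (r_1, \dots, r_k)$ be admissible. Then the following statements are equivalent. (i) The subspace $W(r,U)$ is characteristic. (ii) The subspace $W(r,U)$ is independent of the generator tuple $U$, i.e. $W(r,U) = W(r,\tilde U)$ for all $\tilde U \in \mathcal{U}$. (iii) The tuples $t = (t_1,\dots,t_k)$ and $r = (r_1,\dots,r_k)$ satisfy $r_1 \le \cdots \le r_k$ and $t_1 - r_1 \le \cdots \le t_k - r_k$. (iv) $W(r,U) = W(r)$. (v) $W(r,U)$ is the unique marked subspace $W$ such that the elementary divisors of $W$ and of $V/W$ are $s^{t_1 - r_1}, \dots, s^{t_k - r_k}$ and $s^{r_1}, \dots, s^{r_k}$, respectively. (vi) The subspace $W(r,U)$ is hyperinvariant.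
   Context: Let $\mathrm{End}_f(V)$ be the algebra of all $K$-linear endomorphisms of $V$ that commute with $f$ and $\mathrm{Aut}_f(V)$ the group of all $K$-linear automorphisms of $V$ that commute with $f$. A subspace $X \subseteq V$ is hyperinvariant (for $f$) if $g(X) \subseteq X$ for all $g \in \mathrm{End}_f(V)$. A subspace $X$ is characteristic (with respect to $f$) if $X$ is $f$-invariant and $\alpha(X) = X$ for all $\alpha \in \mathrm{Aut}_f(V)$. For $x \in V$ put $\langle x\rangle = \mathrm{span}\{f^i x : i \ge 0\}$, and let $\mathrm{e}(x)$ (the exponent of $x$) be the smallest integer $\ell \ge 0$ with $f^\ell x = 0$. For $j \ge 0$ put $V[f^j] = \mathrm{Ker} f^j$. A generator tuple of $V$ is a tuple $U = (u_1, \dots, u_k)$ of vectors with $V = \langle u_1\rangle \oplus \cdots \oplus \langle u_k\rangle$ and $\mathrm{e}(u_i) = t_i$ for $i = 1,\dots,k$ (so $\mathrm{e}(u_1) \le \cdots \le \mathrm{e}(u_k)$). $\mathcal{U}$ is the set of generator tuples of $V$. A $k$-tuple $r = (r_1,\dots,r_k)$ of integers is admissible if $0 \le r_i \le t_i$ for $i=1,\dots,k$. For $U \in \mathcal{U}$ and admissible $r$ define $$W(r,U) = \langle f^{r_1}u_1\rangle \oplus \cdots \oplus \langle f^{r_k}u_k\rangle$$ and $$W(r) = \big(f^{r_1}V \cap V[f^{t_1 - r_1}]\big) + \cdots + \big(f^{r_k}V \cap V[f^{t_k - r_k}]\big).$$ A subspace $W$ is marked in $V$ if $W = W(r',U')$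 for some $U' \in \mathcal{U}$ and some admissible $r'$. The elementary divisors of an $f$-invariant subspace $W$ and of $V/W$ are those of the maps induced by $f$ on $W$ and on $V/W$. Lists of elementary divisors are multisets, and the lists in (v) may contain trivial entries $s^0 = 1$, which are to be disregarded. *)

theory Defs
  imports
    "HOL-Library.Set_Algebras"
    "HOL-Computational_Algebra.Polynomial"
    "HOL-Algebra.Module"
begin

text \<open>
  The vector space is the whole type \<open>'v\<close> with scalar multiplication \<open>scale\<close>, and
  \<open>f\<close> is a map on it.  Tuples are lists, indexed from 0.  Sums of subspaces are pointwise sums
  of sets.
\<close>

definition End_f :: "('k::field \<Rightarrow> 'v::ab_group_add \<Rightarrow> 'v) \<Rightarrow> ('v \<Rightarrow> 'v) \<Rightarrow> ('v \<Rightarrow> 'v) set" where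
  "End_f scale f = {g. Vector_Spaces.linear scale scale g \<and> g \<circ> f = f \<circ> g}"

definition Aut_f :: "('k::field \<Rightarrow> 'v::ab_group_add \<Rightarrow> 'v) \<Rightarrow> ('v \<Rightarrow> 'v) \<Rightarrow> ('v \<Rightarrow> 'v) set" where
  "Aut_f scale f = {\<alpha> \<in> End_f scale f. bij \<alpha>}"

definition hyperinvariant ::
  "('k::field \<Rightarrow> 'v::ab_group_add \<Rightarrow> 'v) \<Rightarrow> ('v \<Rightarrow> 'v) \<Rightarrow> 'v set \<Rightarrow> bool" where
  "hyperinvariant scale f X \<longleftrightarrow>
     module.subspace scale X \<and> (\<forall>g \<in> End_f scale f. g ` X \<subseteq> X)"

definition characteristic ::
  "('k::field \<Rightarrow> 'v::ab_group_add \<Rightarrow> 'v) \<Rightarrow> ('v \<Rightarrow> 'v) \<Rightarrow> 'v set \<Rightarrow> bool" where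
  "characteristic scale f X \<longleftrightarrow>
     module.subspace scale X \<and> f ` X \<subseteq> X \<and> (\<forall>\<alpha> \<in> Aut_f scale f. \<alpha> ` X = X)"

definition cyclic_subspace ::
  "('k::field \<Rightarrow> 'v::ab_group_add \<Rightarrow> 'v) \<Rightarrow> ('v \<Rightarrow> 'v) \<Rightarrow> 'v \<Rightarrow> 'v set" where
  "cyclic_subspace scale f x = module.span scale (range (\<lambda>i. (f ^^ i) x))"

text \<open>Meaningful only if some power of \<open>f\<close> annihilates \<open>x\<close>, as is the case for nilpotent \<open>f\<close>.\<close>

definition exponent :: "('v \<Rightarrow> 'v::zero) \<Rightarrow> 'v \<Rightarrow> nat" where
  "exponent f x = (LEAST l. (f ^^ l) x = 0)"

definition is_direct_sum :: "'v::ab_group_add set \<Rightarrow> nat \<Rightarrow> (nat \<Rightarrow> 'v set) \<Rightarrow> bool" where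
  "is_direct_sum V n X \<longleftrightarrow>
     V = (\<Sum>i<n. X i) \<and>
     (\<forall>w. (\<forall>i<n. w i \<in> X i) \<and> (\<Sum>i<n. w i) = 0 \<longrightarrow> (\<forall>i<n. w i = 0))"

definition generator_tuples ::
  "('k::field \<Rightarrow> 'v::ab_group_add \<Rightarrow> 'v) \<Rightarrow> ('v \<Rightarrow> 'v) \<Rightarrow> nat list \<Rightarrow> 'v list set" where
  "generator_tuples scale f t =
     {U. length U = length t \<and>
         is_direct_sum UNIV (length U) (\<lambda>i. cyclic_subspace scale f (U ! i)) \<and>
         (\<forall>i<length t. exponent f (U ! i) = t ! i)}"

definition admissible :: "nat list \<Rightarrow> nat list \<Rightarrow> bool" where
  "admissible t r \<longleftrightarrow> length r = length t \<and> (\<forall>i<length t. r ! i \<le> t ! i)"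

text \<open>For a generator tuple \<open>U\<close> the sum defining \<open>W_gen\<close> is automatically direct.\<close>

definition W_gen ::
  "('k::field \<Rightarrow> 'v::ab_group_add \<Rightarrow> 'v) \<Rightarrow> ('v \<Rightarrow> 'v) \<Rightarrow> nat list \<Rightarrow> 'v list \<Rightarrow> 'v set" where
  "W_gen scale f r U = (\<Sum>i<length U. cyclic_subspace scale f ((f ^^ (r ! i)) (U ! i)))"

definition W_can :: "('v \<Rightarrow> 'v::ab_group_add) \<Rightarrow> nat list \<Rightarrow> nat list \<Rightarrow> 'v set" where
  "W_can f t r =
     (\<Sum>i<length t. range (f ^^ (r ! i)) \<inter> {x. (f ^^ (t ! i - r ! i)) x = 0})"

definition marked ::
  "('k::field \<Rightarrow> 'v::ab_group_add \<Rightarrow> 'v) \<Rightarrow> ('v \<Rightarrow> 'v) \<Rightarrow> nat list \<Rightarrow> 'v set \<Rightarrow> bool" where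
  "marked scale f t W \<longleftrightarrow>
     (\<exists>U' \<in> generator_tuples scale f t. \<exists>r'. admissible t r' \<and> W = W_gen scale f r' U')"

text \<open>
  Subspaces and quotient spaces as vector spaces in their own right are \<open>module\<close> records of
  HOL-Algebra, whose ring fields \<open>mult\<close> and \<open>one\<close> play no role.  Elements of the quotient space
  are cosets \<open>v +o W\<close>; adding \<open>W\<close> after applying a map to a coset yields a full coset again.
\<close>

definition sub_space ::
  "('k::field \<Rightarrow> 'v::ab_group_add \<Rightarrow> 'v) \<Rightarrow> 'v set \<Rightarrow> ('k, 'v) module" where
  "sub_space scale W =
     \<lparr>carrier = W, mult = undefined, one = undefined, zero = 0, add = (+), smult = scale\<rparr>"

definition quotient_space ::
  "('k::field \<Rightarrow> 'v::ab_group_add \<Rightarrow> 'v) \<Rightarrow> 'v set \<Rightarrow> ('k, 'v set) module" where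
  "quotient_space scale W =
     \<lparr>carrier = range (\<lambda>v. v +o W), mult = undefined, one = undefined, zero = W, add = (+),
      smult = (\<lambda>c A. scale c ` A + W)\<rparr>"

definition quotient_map :: "('v \<Rightarrow> 'v::ab_group_add) \<Rightarrow> 'v set \<Rightarrow> 'v set \<Rightarrow> 'v set" where
  "quotient_map f W A = f ` A + W"

text \<open>\<open>poly_act M g p x\<close> is \<open>p(g) x\<close>: the action of \<open>K[s]\<close> on \<open>M\<close> in which \<open>s\<close> acts as \<open>g\<close>.\<close>

definition poly_act ::
  "('k::field, 'a) module \<Rightarrow> ('a \<Rightarrow> 'a) \<Rightarrow> 'k poly \<Rightarrow> 'a \<Rightarrow> 'a" where
  "poly_act M g p x = finsum M (\<lambda>i. coeff p i \<odot>\<^bsub>M\<^esub> (g ^^ i) x) {..degree p}"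

text \<open>
  \<open>D\<close> is the multiset of elementary divisors of the endomorphism \<open>g\<close> of \<open>M\<close>: as a \<open>K[s]\<close>-module,
  \<open>M\<close> is the direct sum of cyclic submodules \<open>K[s] x\<^sub>i \<cong> K[s]/(d\<^sub>i)\<close>, where the \<open>d\<^sub>i\<close> are
  nontrivial powers of monic irreducible polynomials and \<open>D\<close> is the multiset of the \<open>d\<^sub>i\<close>.
\<close>

definition has_elementary_divisors ::
  "('k::field, 'a) module \<Rightarrow> ('a \<Rightarrow> 'a) \<Rightarrow> 'k poly multiset \<Rightarrow> bool" where
  "has_elementary_divisors M g D \<longleftrightarrow>
     (\<exists>xs ds. length xs = length ds \<and> mset ds = D \<and> set xs \<subseteq> carrier M \<and>
        (\<forall>d \<in> set ds. \<exists>q e. irreducible q \<and> lead_coeff q = 1 \<and> 0 < e \<and> d = q ^ e) \<and>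
        (\<forall>i<length xs. \<forall>p. poly_act M g p (xs ! i) = \<zero>\<^bsub>M\<^esub> \<longleftrightarrow> ds ! i dvd p) \<and>
        (\<forall>v \<in> carrier M. \<exists>p. v = finsum M (\<lambda>i. poly_act M g (p i) (xs ! i)) {..<length xs}) \<and>
        (\<forall>p. finsum M (\<lambda>i. poly_act M g (p i) (xs ! i)) {..<length xs} = \<zero>\<^bsub>M\<^esub> \<longrightarrow>
             (\<forall>i<length xs. poly_act M g (p i) (xs ! i) = \<zero>\<^bsub>M\<^esub>)))"

text \<open>The multiset of the polynomials \<open>s\<^sup>n\<close>, for \<open>n\<close> in a list, without trivial entries \<open>s\<^sup>0\<close>.\<close>

definition s_powers :: "nat list \<Rightarrow> 'k::field poly multiset" where
  "s_powers ns = image_mset (monom 1) (filter_mset (\<lambda>n. 0 < n) (mset ns))"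

definition has_divisor_lists ::
  "('k::field \<Rightarrow> 'v::ab_group_add \<Rightarrow> 'v) \<Rightarrow> ('v \<Rightarrow> 'v) \<Rightarrow> nat list \<Rightarrow> nat list \<Rightarrow> 'v set \<Rightarrow> bool" where
  "has_divisor_lists scale f t r W \<longleftrightarrow>
     has_elementary_divisors (sub_space scale W) f (s_powers (map2 (-) t r)) \<and>
     has_elementary_divisors (quotient_space scale W) (quotient_map f W) (s_powers r)"

end

theory Submission
  imports Defs "HOL-Computational_Algebra.Polynomial_Factorial"
begin

text \<open>
  Write \<open>s\<close> for the indeterminate and regard \<open>V\<close> as a \<open>K[s]\<close>-module in which \<open>s\<close> acts as \<open>f\<close>.  A generator
  tuple presents \<open>V\<close> as the direct sum of the modules \<open>K[s]/(s\<^bsup>t i\<^esup>)\<close>, so a vector is given by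
  coordinates \<open>p i\<close>, polynomials modulo \<open>s\<^bsup>t i\<^esup>\<close>, and it lies in \<open>W(r, U)\<close> iff \<open>s\<^bsup>r i\<^esup>\<close> divides \<open>p i\<close> for
  all \<open>i\<close> (\<open>sum_act_in_W_gen_iff\<close>).  This reduces almost everything to divisibility of powers of \<open>s\<close>.

  Conditions (i) and (ii) say the same thing: endomorphisms commuting with \<open>f\<close> can be prescribed on
  generators, so the automorphisms act transitively on generator tuples
  (\<open>characteristic_iff_independent\<close>).  For (i) \<open>\<Longrightarrow>\<close> (iii) it suffices to test invariance on the
  transvections \<open>u\<^sub>i \<mapsto> u\<^sub>i + f\<^sup>n u\<^sub>j\<close> (\<open>characteristic_imp_le\<close>).  Under (iii), the two monotonicity
  conditions are what makes each summand \<open>f\<^bsup>r i\<^esup> V \<inter> V[f\<^bsup>t i - r i\<^esup>]\<close> of \<open>W(r)\<close> lie in \<open>W(r, U)\<close>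
  (\<open>W_can_subset_W_gen\<close>), while the converse inclusion always holds; this is (iv).  As images and kernels
  of powers of \<open>f\<close> are hyperinvariant, (iv) implies (vi), and hyperinvariant subspaces are characteristic.

  For (v), the decompositions of \<open>W(r, U)\<close> and \<open>V/W(r, U)\<close> into cyclic modules with exponents \<open>t i - r i\<close>
  and \<open>r i\<close> show that every \<open>W(r, U')\<close> has the prescribed elementary divisors, so (v) implies (ii).
  Conversely, elementary divisors are determined by the dimensions of the images of the powers of \<open>f\<close>
  (\<open>dim_image_cyclic_decomp\<close>), hence a marked subspace \<open>W(r', U')\<close> with the same divisors has \<open>r'\<close> and
  \<open>t - r'\<close> equal to \<open>r\<close> and \<open>t - r\<close> up to order.  If \<open>r\<close> and \<open>t - r\<close> are sorted this forces \<open>r' = r\<close>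
  (\<open>eq_if_sorted_and_differences_sorted\<close>), and then (ii) gives \<open>W(r', U') = W(r, U)\<close>.
\<close>

section \<open>The action of polynomials in \<open>f\<close>\<close>

locale linear_endomorphism = vector_space scale
  for scale :: "'k::field \<Rightarrow> 'v::ab_group_add \<Rightarrow> 'v" (infixr "*s" 75) +
  fixes f :: "'v \<Rightarrow> 'v"
  assumes linear_f: "Vector_Spaces.linear scale scale f"
begin

lemma linear_funpow: "Vector_Spaces.linear scale scale (f ^^ n)"
proof (induction n)
  case 0
  then show ?case
    using linear_id by (simp add: id_def)
next
  case (Suc n)
  then show ?case
    using linear_f Vector_Spaces.linear_compose by (auto simp: o_def)
qed

lemma f_add: "f (x + y) = f x + f y"
  and f_scale: "f (c *s x) = c *s f x"
  and f_0 [simp]: "f 0 = 0"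
  and f_sum: "f (sum h A) = (\<Sum>a\<in>A. f (h a))"
proof -
  interpret F: Vector_Spaces.linear scale scale f by (rule linear_f)
  show "f (x + y) = f x + f y" "f (c *s x) = c *s f x" "f 0 = 0" "f (sum h A) = (\<Sum>a\<in>A. f (h a))"
    by (rule F.add F.scale F.zero F.sum)+
qed

lemma funpow_zero [simp]: "(f ^^ n) 0 = 0"
  by (induction n) auto

definition act :: "'k poly \<Rightarrow> 'v \<Rightarrow> 'v" where
  "act p x = (\<Sum>a\<le>degree p. coeff p a *s (f ^^ a) x)"

lemma act_eq_sum: "degree p \<le> n \<Longrightarrow> act p x = (\<Sum>a\<le>n. coeff p a *s (f ^^ a) x)"
  unfolding act_def by (rule sum.mono_neutral_left) (auto simp: coeff_eq_0)

lemma act_0 [simp]: "act 0 x = 0"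
  by (simp add: act_def)

lemma act_1 [simp]: "act 1 x = x"
  by (simp add: act_def)

lemma act_add: "act (p + q) x = act p x + act q x"
proof -
  let ?n = "max (degree p) (degree q)"
  have "degree (p + q) \<le> ?n" by (rule degree_add_le) auto
  then show ?thesis
    by (simp add: act_eq_sum[of _ ?n] scale_left_distrib sum.distrib)
qed

lemma act_smult: "act (Polynomial.smult c p) x = c *s act p x"
  using act_eq_sum[OF degree_smult_le, of c p x] by (simp add: act_def scale_sum_right)

lemma act_minus: "act (- p) x = - act p x"
  using act_smult[of "-1" p x] by simp

lemma act_diff: "act (p - q) x = act p x - act q x"
  using act_add[of p "- q" x] by (simp add: act_minus)

lemma act_sum: "act (sum p A) x = (\<Sum>a\<in>A. act (p a) x)"
  by (induction A rule: infinite_finite_induct) (auto simp: act_add)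

lemma act_monom: "act (monom c n) x = c *s (f ^^ n) x"
proof (cases "c = 0")
  case False
  then have "act (monom c n) x = (\<Sum>a\<le>n. (if n = a then c else 0) *s (f ^^ a) x)"
    by (simp add: act_def degree_monom_eq)
  also have "\<dots> = (\<Sum>a\<le>n. if n = a then c *s (f ^^ a) x else 0)"
    by (rule sum.cong) auto
  finally show ?thesis by simp
qed simp

lemma funpow_eq_act: "(f ^^ n) x = act (monom 1 n) x"
  by (simp add: act_monom)

lemma act_linear: "Vector_Spaces.linear scale scale (act p)"
proof -
  interpret P: vector_space_pair scale scale by unfold_locales
  show ?thesis
    unfolding act_def
    by (intro P.linear_compose_sum P.linear_compose_scale_right ballI linear_funpow)
qed

lemma act_pCons: "act (pCons c p) x = c *s x + f (act p x)"
proof -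
  have "act (pCons c p) x = (\<Sum>a\<le>Suc (degree p). coeff (pCons c p) a *s (f ^^ a) x)"
    by (rule act_eq_sum) (simp add: degree_pCons_le)
  also have "\<dots> = c *s x + f (act p x)"
    by (simp add: sum.atMost_Suc_shift act_def f_sum f_scale del: sum.atMost_Suc)
  finally show ?thesis .
qed

lemma act_mult: "act (p * q) x = act p (act q x)"
  by (induction p) (simp_all add: act_pCons act_add act_smult)

lemma act_vec_0 [simp]: "act p 0 = 0"
  and act_vec_diff: "act p (x - y) = act p x - act p y"
  and act_vec_sum: "act p (sum h A) = (\<Sum>a\<in>A. act p (h a))"
proof -
  interpret F: Vector_Spaces.linear scale scale "act p" by (rule act_linear)
  show "act p 0 = 0" "act p (x - y) = act p x - act p y"
      "act p (sum h A) = (\<Sum>a\<in>A. act p (h a))"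
    by (rule F.zero F.diff F.sum)+
qed

lemma act_closed:
  assumes "subspace S" "f ` S \<subseteq> S" "x \<in> S"
  shows "act p x \<in> S"
proof (induction p)
  case 0
  show ?case using assms(1) by (simp add: subspace_0)
next
  case (pCons c p)
  have "c *s x + f (act p x) \<in> S"
    using assms pCons.IH by (intro subspace_add subspace_scale) auto
  then show ?case by (simp add: act_pCons)
qed

lemma act_commute_End:
  assumes "g \<in> End_f scale f"
  shows "g (act p x) = act p (g x)"
proof -
  interpret G: Vector_Spaces.linear scale scale g using assms by (simp add: End_f_def)
  have "g (f y) = f (g y)" for y
    using assms by (auto simp: End_f_def fun_eq_iff)
  then show ?thesis
    by (induction p) (simp_all add: act_pCons G.add G.scale)
qed

lemma act_eq_0_if_dvd:
  assumes "(f ^^ e) x = 0" "monom 1 e dvd p"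
  shows "act p x = 0"
proof -
  obtain q where "p = q * monom 1 e" using assms(2) by (metis dvd_def mult.commute)
  then show ?thesis using assms(1) by (simp add: act_mult act_monom)
qed

lemma cyclic_subspace_eq: "cyclic_subspace scale f x = range (\<lambda>p. act p x)"
proof
  have "subspace (range (\<lambda>p. act p x))"
  proof (rule subspaceI)
    show "0 \<in> range (\<lambda>p. act p x)" by (metis act_0 rangeI)
    show "y + z \<in> range (\<lambda>p. act p x)"
      if "y \<in> range (\<lambda>p. act p x)" "z \<in> range (\<lambda>p. act p x)" for y z
      using that by (auto simp flip: act_add)
    show "c *s y \<in> range (\<lambda>p. act p x)" if "y \<in> range (\<lambda>p. act p x)" for c y
      using that by (auto simp flip: act_smult)
  qed
  then show "cyclic_subspace scale f x \<subseteq> range (\<lambda>p. act p x)"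
    unfolding cyclic_subspace_def by (intro span_minimal) (unfold funpow_eq_act, blast)
  show "range (\<lambda>p. act p x) \<subseteq> cyclic_subspace scale f x"
    unfolding cyclic_subspace_def act_def
    by (rule image_subsetI, intro span_sum span_scale, rule span_base, rule rangeI)
qed

text \<open>
  If the lowest term \<open>c s\<^sup>m\<close> of \<open>p\<close> has \<open>m < e\<close>, then applying \<open>f\<close> another \<open>e - 1 - m\<close> times to
  \<open>p(f) x\<close> kills every term except the lowest, and \<open>c f\<^bsup>e-1\<^esup> x\<close> is not zero.
\<close>

lemma act_eq_0_iff:
  assumes nz: "e > 0 \<Longrightarrow> (f ^^ (e - 1)) x \<noteq> 0" and z: "(f ^^ e) x = 0"
  shows "act p x = 0 \<longleftrightarrow> monom 1 e dvd p"
proof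
  assume 0: "act p x = 0"
  show "monom 1 e dvd p"
  proof (rule ccontr)
    assume "\<not> monom 1 e dvd p"
    then obtain k where k: "k < e" "coeff p k \<noteq> 0"
      unfolding monom_1_dvd_iff' by blast
    define m where "m = (LEAST k. coeff p k \<noteq> 0)"
    have m: "m < e" "coeff p m \<noteq> 0"
      using Least_le[of "\<lambda>k. coeff p k \<noteq> 0", OF k(2)] k(1) LeastI[of "\<lambda>k. coeff p k \<noteq> 0", OF k(2)]
      unfolding m_def by auto
    have least: "coeff p k = 0" if "k < m" for k
      using not_less_Least that unfolding m_def by blast
    \<comment> \<open>Multiplication by \<open>s\<close> to the power \<open>?d\<close> moves the lowest term to degree \<open>e - 1\<close>, the last degree
      that acts nontrivially on \<open>x\<close>.\<close>
    let ?d = "e - 1 - m"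
    have "monom 1 (Suc m) dvd p - monom (coeff p m) m"
      using least by (auto simp: monom_1_dvd_iff' less_Suc_eq)
    then have "monom 1 ?d * monom 1 (Suc m) dvd monom 1 ?d * (p - monom (coeff p m) m)"
      by (rule mult_dvd_mono[OF dvd_refl])
    then have "monom 1 e dvd monom 1 ?d * p - monom (coeff p m) (e - 1)"
      using m by (simp add: mult_monom right_diff_distrib)
    then have "act (monom 1 ?d * p - monom (coeff p m) (e - 1)) x = 0"
      by (rule act_eq_0_if_dvd[OF z])
    then have "coeff p m *s (f ^^ (e - 1)) x = 0"
      using 0 by (simp add: act_diff act_mult act_monom)
    then show False using m nz by simp
  qed
qed (rule act_eq_0_if_dvd[OF z])

section \<open>Cyclic decompositions relative to a subspace\<close>

text \<open>
  For invariant subspaces \<open>N \<subseteq> S\<close>: the \<open>K[s]\<close>-module \<open>S/N\<close> is the direct sum of the cyclic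
  submodules generated by the classes of the \<open>x i\<close>, and the class of \<open>x i\<close> has annihilator
  \<open>(s\<^bsup>e i\<^esup>)\<close>.  The last conjunct expresses both the directness of the sum and the annihilators.
  Exponents \<open>e i = 0\<close> are allowed, so that \<open>W(r, U)\<close> and \<open>V/W(r, U)\<close> can be indexed like \<open>U\<close> even
  where \<open>r i = t i\<close> or \<open>r i = 0\<close>.  Working modulo \<open>N\<close> covers \<open>V\<close>, \<open>W(r, U)\<close> (both with \<open>N = 0\<close>) and
  \<open>V/W(r, U)\<close> at once.
\<close>

definition cyclic_decomp :: "'v set \<Rightarrow> 'v set \<Rightarrow> 'i set \<Rightarrow> ('i \<Rightarrow> 'v) \<Rightarrow> ('i \<Rightarrow> nat) \<Rightarrow> bool" where
  "cyclic_decomp S N I x e \<longleftrightarrow>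
     (\<forall>i\<in>I. x i \<in> S) \<and>
     (\<forall>v\<in>S. \<exists>p. v - (\<Sum>i\<in>I. act (p i) (x i)) \<in> N) \<and>
     (\<forall>p. (\<Sum>i\<in>I. act (p i) (x i)) \<in> N \<longleftrightarrow> (\<forall>i\<in>I. monom 1 (e i) dvd p i))"

lemma cyclic_decomp_single:
  assumes "cyclic_decomp S N I x e" "finite I" "i \<in> I"
  shows "act p (x i) \<in> N \<longleftrightarrow> monom 1 (e i) dvd p"
proof -
  have "(\<Sum>j\<in>I. act (if j = i then p else 0) (x j)) = (\<Sum>j\<in>I. if j = i then act p (x j) else 0)"
    by (rule sum.cong) auto
  then have "(\<Sum>j\<in>I. act (if j = i then p else 0) (x j)) = act p (x i)"
    using assms by simp
  moreover have "(\<Sum>j\<in>I. act (if j = i then p else 0) (x j)) \<in> N \<longleftrightarrow>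
      (\<forall>j\<in>I. monom 1 (e j) dvd (if j = i then p else 0))"
    using assms(1) unfolding cyclic_decomp_def by (elim conjE allE)
  ultimately show ?thesis using assms(3) by auto
qed

text \<open>
  Summands with exponent \<open>0\<close> lie in \<open>N\<close>, hence they can be dropped; this is how the trivial entries
  \<open>s\<^sup>0\<close> of a list of elementary divisors disappear.
\<close>

lemma cyclic_decomp_restrict:
  assumes dec: "cyclic_decomp S N I x e" and I: "finite I" and N: "subspace N"
  shows "cyclic_decomp S N {i\<in>I. 0 < e i} x e"
proof -
  let ?J = "{i\<in>I. 0 < e i}"
  have triv: "(\<Sum>i\<in>I. act (p i) (x i)) - (\<Sum>i\<in>?J. act (p i) (x i)) \<in> N" for p
  proof -
    have "(\<Sum>i\<in>I. act (p i) (x i)) - (\<Sum>i\<in>?J. act (p i) (x i)) = (\<Sum>i\<in>I-?J. act (p i) (x i))"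
      by (subst sum_diff) (use I in auto)
    also have "\<dots> \<in> N"
    proof (rule subspace_sum[OF N])
      fix i assume "i \<in> I - ?J"
      then show "act (p i) (x i) \<in> N"
        using cyclic_decomp_single[OF dec I, of i] by auto
    qed
    finally show ?thesis .
  qed
  have "\<exists>p. v - (\<Sum>i\<in>?J. act (p i) (x i)) \<in> N" if "v \<in> S" for v
  proof -
    obtain p where "v - (\<Sum>i\<in>I. act (p i) (x i)) \<in> N"
      using dec \<open>v \<in> S\<close> unfolding cyclic_decomp_def by blast
    from subspace_add[OF N this triv[of p]] show ?thesis by auto
  qed
  moreover have "(\<Sum>i\<in>?J. act (p i) (x i)) \<in> N \<longleftrightarrow> (\<forall>i\<in>?J. monom 1 (e i) dvd p i)" for p
  proof -
    have "(\<Sum>i\<in>?J. act (p i) (x i)) \<in> N \<longleftrightarrow> (\<Sum>i\<in>I. act (p i) (x i)) \<in> N"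
      using subspace_add[OF N triv[of p], of "\<Sum>i\<in>?J. act (p i) (x i)"]
        subspace_diff[OF N _ triv[of p], of "\<Sum>i\<in>I. act (p i) (x i)"] by auto
    also have "\<dots> \<longleftrightarrow> (\<forall>i\<in>I. monom 1 (e i) dvd p i)"
      using dec unfolding cyclic_decomp_def by blast
    also have "\<dots> \<longleftrightarrow> (\<forall>i\<in>?J. monom 1 (e i) dvd p i)"
    proof -
      have "monom 1 (e i) dvd p i" if "\<not> 0 < e i" for i using that by simp
      then show ?thesis by blast
    qed
    finally show ?thesis .
  qed
  moreover have "\<forall>i\<in>?J. x i \<in> S" using dec unfolding cyclic_decomp_def by blast
  ultimately show ?thesis unfolding cyclic_decomp_def by blast
qed

lemma cyclic_decomp_reindex:
  assumes dec: "cyclic_decomp S N I x e" and h: "bij_betw h J I"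
  shows "cyclic_decomp S N J (x \<circ> h) (e \<circ> h)"
proof -
  let ?k = "inv_into J h"
  have sum: "(\<Sum>j\<in>J. act (q j) ((x \<circ> h) j)) = (\<Sum>i\<in>I. act (q (?k i)) (x i))" for q
    using sum.reindex_bij_betw[OF h, of "\<lambda>i. act (q (?k i)) (x i)"] h
    by (simp add: bij_betw_inv_into_left)
  have k: "?k (h j) = j" if "j \<in> J" for j
    using h that by (rule bij_betw_inv_into_left)
  have hJ: "h ` J = I" using h by (rule bij_betw_imp_surj_on)
  have "\<exists>q. v - (\<Sum>j\<in>J. act (q j) ((x \<circ> h) j)) \<in> N" if "v \<in> S" for v
  proof -
    obtain p where p: "v - (\<Sum>i\<in>I. act (p i) (x i)) \<in> N"
      using dec \<open>v \<in> S\<close> unfolding cyclic_decomp_def by blast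
    have "(\<Sum>j\<in>J. act (p (h j)) ((x \<circ> h) j)) = (\<Sum>i\<in>I. act (p i) (x i))"
      using sum.reindex_bij_betw[OF h, of "\<lambda>i. act (p i) (x i)"] by simp
    then show ?thesis using p by metis
  qed
  moreover have "(\<Sum>j\<in>J. act (q j) ((x \<circ> h) j)) \<in> N \<longleftrightarrow> (\<forall>j\<in>J. monom 1 ((e \<circ> h) j) dvd q j)" for q
  proof -
    have "(\<Sum>i\<in>I. act (q (?k i)) (x i)) \<in> N \<longleftrightarrow> (\<forall>i\<in>I. monom 1 (e i) dvd q (?k i))"
      using dec unfolding cyclic_decomp_def by (elim conjE allE)
    also have "\<dots> \<longleftrightarrow> (\<forall>j\<in>J. monom 1 (e (h j)) dvd q j)"
      unfolding hJ[symmetric] using k by simp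
    finally show ?thesis unfolding sum by simp
  qed
  moreover have "\<forall>j\<in>J. (x \<circ> h) j \<in> S"
    using dec hJ unfolding cyclic_decomp_def by auto
  ultimately show ?thesis unfolding cyclic_decomp_def by blast
qed

end

section \<open>Divisibility of powers of the indeterminate\<close>

lemma monom_1_dvd_monom_1_iff: "monom (1::'a::field) m dvd monom 1 n \<longleftrightarrow> m \<le> n"
  by (auto simp: monom_1_dvd_iff' not_less intro: leI)

lemma monom_1_dvd_monom_1_mult_iff:
  "monom (1::'a::field) m dvd monom 1 n * p \<longleftrightarrow> monom 1 (m - n) dvd p"
proof (cases "n \<le> m")
  case True
  then have "monom (1::'a) m = monom 1 n * monom 1 (m - n)" by (simp add: mult_monom)
  then show ?thesis by (simp add: monom_eq_0_iff)
next
  case False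
  then have "monom (1::'a) m dvd monom 1 n" by (simp add: monom_1_dvd_monom_1_iff)
  then show ?thesis using False by (simp add: dvd_mult2)
qed

section \<open>Dimensions of the images of the powers of \<open>f\<close>\<close>

context vector_space
begin

lemma span_Un_family:
  assumes N: "subspace N" and v: "v \<in> span (N \<union> b ` K)" and K: "finite K"
  shows "\<exists>c. v - (\<Sum>k\<in>K. scale (c k) (b k)) \<in> N"
proof -
  let ?X = "{v. \<exists>c. v - (\<Sum>k\<in>K. scale (c k) (b k)) \<in> N}"
  have "subspace ?X"
  proof (rule subspaceI)
    have "0 - (\<Sum>k\<in>K. scale 0 (b k)) \<in> N" using N by (simp add: subspace_0)
    then show "0 \<in> ?X" by (intro CollectI exI)
  next
    fix y z assume "y \<in> ?X" "z \<in> ?X"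
    then obtain c d where cd: "y - (\<Sum>k\<in>K. scale (c k) (b k)) \<in> N" "z - (\<Sum>k\<in>K. scale (d k) (b k)) \<in> N"
      by blast
    have "y + z - (\<Sum>k\<in>K. scale (c k + d k) (b k))
        = (y - (\<Sum>k\<in>K. scale (c k) (b k))) + (z - (\<Sum>k\<in>K. scale (d k) (b k)))"
      by (simp add: scale_left_distrib sum.distrib)
    also have "\<dots> \<in> N" by (rule subspace_add[OF N cd])
    finally show "y + z \<in> ?X" by (intro CollectI exI)
  next
    fix a y assume "y \<in> ?X"
    then obtain c where c: "y - (\<Sum>k\<in>K. scale (c k) (b k)) \<in> N" by blast
    have "scale a y - (\<Sum>k\<in>K. scale (a * c k) (b k)) = scale a (y - (\<Sum>k\<in>K. scale (c k) (b k)))"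
      by (simp add: scale_right_diff_distrib scale_sum_right)
    also have "\<dots> \<in> N" by (rule subspace_scale[OF N c])
    finally show "scale a y \<in> ?X" by (intro CollectI exI)
  qed
  moreover have "N \<union> b ` K \<subseteq> ?X"
  proof (intro Un_least subsetI)
    fix y assume "y \<in> N"
    then have "y - (\<Sum>k\<in>K. scale 0 (b k)) \<in> N" by simp
    then show "y \<in> ?X" by (intro CollectI exI)
  next
    fix y assume "y \<in> b ` K"
    then obtain k where k: "k \<in> K" "y = b k" by blast
    have "(\<Sum>l\<in>K. scale (if l = k then 1 else 0) (b l)) = (\<Sum>l\<in>K. if l = k then b l else 0)"
      by (rule sum.cong) auto
    then have "y - (\<Sum>l\<in>K. scale (if l = k then 1 else 0) (b l)) \<in> N"
      using k K N by (simp add: subspace_0)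
    then show "y \<in> ?X" by (intro CollectI exI)
  qed
  ultimately have "span (N \<union> b ` K) \<subseteq> ?X" by (intro span_minimal)
  then show ?thesis using v by blast
qed

end

context finite_dimensional_vector_space
begin

text \<open>
  Counts a family that is linearly independent modulo \<open>N\<close>, by adding its members one at a time:
  if \<open>b k\<close> were in the span of \<open>N\<close> and the earlier members, there would be a nontrivial relation
  modulo \<open>N\<close>.
\<close>

lemma dim_Un_family:
  assumes N: "subspace N" and K: "finite K"
    and indep: "\<And>c. (\<Sum>k\<in>K. scale (c k) (b k)) \<in> N \<Longrightarrow> \<forall>k\<in>K. c k = 0"
  shows "dim (N \<union> b ` K) = dim N + card K"
  using K indep
proof (induction K)
  case empty
  then show ?case by simp
next
  case (insert k K)
  have IH: "dim (N \<union> b ` K) = dim N + card K"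
  proof (rule insert.IH)
    fix c assume c: "(\<Sum>l\<in>K. scale (c l) (b l)) \<in> N"
    have "(\<Sum>l\<in>K. scale (if l = k then 0 else c l) (b l)) = (\<Sum>l\<in>K. scale (c l) (b l))"
      using insert.hyps by (intro sum.cong) auto
    then have "(\<Sum>l\<in>insert k K. scale (if l = k then 0 else c l) (b l)) \<in> N"
      using c insert.hyps by simp
    then have *: "\<forall>l\<in>insert k K. (if l = k then 0 else c l) = 0" by (rule insert.prems)
    show "\<forall>l\<in>K. c l = 0"
    proof
      fix l assume "l \<in> K"
      then show "c l = 0" using bspec[OF *, of l] insert.hyps(2) by (cases "l = k") auto
    qed
  qed
  have "b k \<notin> span (N \<union> b ` K)"
  proof
    assume "b k \<in> span (N \<union> b ` K)"
    from span_Un_family[OF N this insert.hyps(1)]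
    obtain c where c: "b k - (\<Sum>l\<in>K. scale (c l) (b l)) \<in> N" by blast
    have "(\<Sum>l\<in>K. scale (if l = k then 1 else - c l) (b l)) = - (\<Sum>l\<in>K. scale (c l) (b l))"
      unfolding sum_negf[symmetric] using insert.hyps by (intro sum.cong) auto
    then have "(\<Sum>l\<in>insert k K. scale (if l = k then 1 else - c l) (b l)) \<in> N"
      using c insert.hyps by simp
    from insert.prems[OF this] show False by auto
  qed
  then show ?case using IH insert.hyps by (simp add: dim_insert)
qed

end

locale fin_dim_endomorphism =
  linear_endomorphism scale f + finite_dimensional_vector_space scale Basis
  for scale :: "'k::field \<Rightarrow> 'v::ab_group_add \<Rightarrow> 'v" (infixr "*s" 75) and f Basis
begin

text \<open>
  The vectors \<open>f\<^sup>a (x i)\<close> with \<open>j \<le> a < e i\<close> form a basis of \<open>f\<^sup>j S + N\<close> modulo \<open>N\<close>.  Since the left-hand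
  side does not mention the decomposition, these formulas for all \<open>j\<close> make the positive exponents
  invariants of \<open>(S, N)\<close>.
\<close>

lemma dim_image_cyclic_decomp:
  assumes dec: "cyclic_decomp S N I x e" and I: "finite I"
    and S: "subspace S" "f ` S \<subseteq> S" and N: "subspace N" "f ` N \<subseteq> N" "N \<subseteq> S"
  shows "dim (N \<union> (f ^^ j) ` S) = dim N + (\<Sum>i\<in>I. e i - j)"
proof -
  let ?K = "SIGMA i:I. {j..<e i}"
  let ?b = "\<lambda>(i, a). (f ^^ a) (x i)"
  have K: "finite ?K" using I by auto
  have xS: "x i \<in> S" if "i \<in> I" for i
    using dec that unfolding cyclic_decomp_def by blast
  \<comment> \<open>A relation modulo \<open>N\<close> has coefficient polynomials of degree below \<open>e i\<close> that \<open>s\<^bsup>e i\<^esup>\<close> divides.\<close>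
  have indep: "\<forall>k\<in>?K. c k = 0" if c: "(\<Sum>k\<in>?K. c k *s ?b k) \<in> N" for c
  proof -
    let ?p = "\<lambda>i. \<Sum>a\<in>{j..<e i}. monom (c (i, a)) a"
    have "(\<Sum>k\<in>?K. c k *s ?b k) = (\<Sum>i\<in>I. act (?p i) (x i))"
      using I by (simp add: sum.Sigma act_sum act_monom case_prod_unfold)
    then have "\<forall>i\<in>I. monom 1 (e i) dvd ?p i"
      using c dec unfolding cyclic_decomp_def by simp
    then have 0: "coeff (?p i) a = 0" if "i \<in> I" "a < e i" for i a
      using that by (auto simp: monom_1_dvd_iff')
    show ?thesis
    proof safe
      fix i a assume ia: "i \<in> I" "a \<in> {j..<e i}"
      have "coeff (?p i) a = c (i, a)" using ia by (simp add: coeff_sum)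
      then show "c (i, a) = 0" using 0[of i a] ia by simp
    qed
  qed
  have act_span: "act q (x i) \<in> span (N \<union> ?b ` ?K)" if i: "i \<in> I" and q: "monom 1 j dvd q" for i q
    unfolding act_def
  proof (intro span_sum)
    fix a
    consider "a < j" | "j \<le> a" "a < e i" | "e i \<le> a" by linarith
    then show "coeff q a *s (f ^^ a) (x i) \<in> span (N \<union> ?b ` ?K)"
    proof cases
      case 1
      then show ?thesis using q by (simp add: monom_1_dvd_iff' span_zero)
    next
      case 2
      then have "(f ^^ a) (x i) \<in> ?b ` ?K" using i by force
      then show ?thesis by (intro span_scale span_base) blast
    next
      case 3
      then have "(f ^^ a) (x i) \<in> N"
        unfolding funpow_eq_act using cyclic_decomp_single[OF dec I i]
        by (simp add: monom_1_dvd_monom_1_iff)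
      then show ?thesis by (intro span_scale span_base) blast
    qed
  qed
  have "span (N \<union> ?b ` ?K) = span (N \<union> (f ^^ j) ` S)"
  proof (rule subset_antisym; rule span_minimal[OF _ subspace_span]; rule Un_least)
    show "N \<subseteq> span (N \<union> (f ^^ j) ` S)" "N \<subseteq> span (N \<union> ?b ` ?K)"
      using span_superset by blast+
    show "?b ` ?K \<subseteq> span (N \<union> (f ^^ j) ` S)"
    proof safe
      fix i a assume ia: "i \<in> I" "a \<in> {j..<e i}"
      then have "(f ^^ a) (x i) = (f ^^ j) (act (monom 1 (a - j)) (x i))"
        by (simp add: act_monom funpow_add[symmetric] flip: comp_apply[of "f ^^ j"])
      moreover have "act (monom 1 (a - j)) (x i) \<in> S"
        by (rule act_closed[OF S xS[OF ia(1)]])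
      ultimately have "(f ^^ a) (x i) \<in> (f ^^ j) ` S" by blast
      then show "(f ^^ a) (x i) \<in> span (N \<union> (f ^^ j) ` S)" by (intro span_base) blast
    qed
    show "(f ^^ j) ` S \<subseteq> span (N \<union> ?b ` ?K)"
    proof safe
      fix v assume "v \<in> S"
      then obtain p where p: "v - (\<Sum>i\<in>I. act (p i) (x i)) \<in> N"
        using dec unfolding cyclic_decomp_def by blast
      have "(f ^^ j) v = act (monom 1 j) (v - (\<Sum>i\<in>I. act (p i) (x i)))
          + (\<Sum>i\<in>I. act (monom 1 j * p i) (x i))"
        by (simp add: funpow_eq_act act_vec_diff act_vec_sum act_mult)
      also have "\<dots> \<in> span (N \<union> ?b ` ?K)"
        using act_closed[OF N(1,2) p]
        by (intro span_add span_sum act_span) (auto intro: span_base)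
      finally show "(f ^^ j) v \<in> span (N \<union> ?b ` ?K)" .
    qed
  qed
  then have "dim (N \<union> (f ^^ j) ` S) = dim (N \<union> ?b ` ?K)"
    by (metis dim_span)
  also have "\<dots> = dim N + card ?K"
    by (rule dim_Un_family[OF N(1) K indep])
  finally show ?thesis using I by simp
qed

end

section \<open>Endomorphisms commuting with \<open>f\<close>\<close>

context linear_endomorphism
begin

lemma End_f_0: "g \<in> End_f scale f \<Longrightarrow> g 0 = 0"
  and End_f_sum: "g \<in> End_f scale f \<Longrightarrow> g (sum h A) = (\<Sum>a\<in>A. g (h a))"
  and End_f_funpow: "g \<in> End_f scale f \<Longrightarrow> g ((f ^^ n) v) = (f ^^ n) (g v)"
proof -
  assume g: "g \<in> End_f scale f"
  interpret G: Vector_Spaces.linear scale scale g using g by (simp add: End_f_def)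
  show "g 0 = 0" "g (sum h A) = (\<Sum>a\<in>A. g (h a))"
    by (rule G.zero G.sum)+
  show "g ((f ^^ n) v) = (f ^^ n) (g v)"
    using act_commute_End[OF g, of "monom 1 n"] by (simp add: act_monom)
qed

lemma cyclic_decomp_repr:
  assumes "cyclic_decomp UNIV {0} I u t"
  obtains p where "v = (\<Sum>i\<in>I. act (p i) (u i))"
proof -
  obtain p where "v - (\<Sum>i\<in>I. act (p i) (u i)) = 0"
    using assms unfolding cyclic_decomp_def by blast
  then show thesis using that[of p] by simp
qed

lemma End_f_eqI:
  assumes dec: "cyclic_decomp UNIV {0} I u t"
    and g: "g \<in> End_f scale f" and h: "h \<in> End_f scale f" and eq: "\<And>i. i \<in> I \<Longrightarrow> g (u i) = h (u i)"
  shows "g = h"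
proof
  fix v
  obtain p where v: "v = (\<Sum>i\<in>I. act (p i) (u i))" by (rule cyclic_decomp_repr[OF dec])
  show "g v = h v"
    unfolding v using eq by (simp add: End_f_sum g h act_commute_End)
qed

text \<open>
  The generators can be sent anywhere compatible with their annihilators: the coefficient polynomials
  of a vector are unique up to multiples of \<open>s\<^bsup>t i\<^esup>\<close>, and these act as zero on \<open>w i\<close>.
\<close>

lemma End_f_extend:
  assumes dec: "cyclic_decomp UNIV {0} I u t"
    and w: "\<And>i. i \<in> I \<Longrightarrow> (f ^^ t i) (w i) = 0" and I: "finite I"
  obtains g where "g \<in> End_f scale f" "\<And>i. i \<in> I \<Longrightarrow> g (u i) = w i"
proof -
  define P where "P v = (SOME p. v = (\<Sum>i\<in>I. act (p i) (u i)))" for v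
  have P: "v = (\<Sum>i\<in>I. act (P v i) (u i))" for v
  proof -
    obtain p where "v = (\<Sum>i\<in>I. act (p i) (u i))" by (rule cyclic_decomp_repr[OF dec])
    then show ?thesis unfolding P_def by (rule someI[where P = "\<lambda>p. v = (\<Sum>i\<in>I. act (p i) (u i))"])
  qed
  define g where "g v = (\<Sum>i\<in>I. act (P v i) (w i))" for v
  have g: "g (\<Sum>i\<in>I. act (p i) (u i)) = (\<Sum>i\<in>I. act (p i) (w i))" for p
  proof -
    let ?v = "\<Sum>i\<in>I. act (p i) (u i)"
    have "(\<Sum>i\<in>I. act (P ?v i - p i) (u i)) = (\<Sum>i\<in>I. act (P ?v i) (u i)) - ?v"
      by (simp add: act_diff sum_subtractf)
    then have "(\<Sum>i\<in>I. act (P ?v i - p i) (u i)) \<in> {0}" using P[of ?v] by simp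
    moreover have "(\<Sum>i\<in>I. act (q i) (u i)) \<in> {0} \<longleftrightarrow> (\<forall>i\<in>I. monom 1 (t i) dvd q i)" for q
      using dec unfolding cyclic_decomp_def by blast
    ultimately have "\<forall>i\<in>I. monom 1 (t i) dvd P ?v i - p i" by (simp only:)
    then have "act (P ?v i - p i) (w i) = 0" if "i \<in> I" for i
      using that w act_eq_0_if_dvd by blast
    then show ?thesis unfolding g_def by (intro sum.cong) (auto simp: act_diff)
  qed
  have "Vector_Spaces.linear scale scale g"
  proof
    fix v v' c
    have "v + v' = (\<Sum>i\<in>I. act (P v i + P v' i) (u i))"
      using P[of v] P[of v'] by (simp add: act_add sum.distrib)
    then show "g (v + v') = g v + g v'"
      unfolding g_def[of v] g_def[of v'] by (simp only: g) (simp add: act_add sum.distrib)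
    have "c *s v = (\<Sum>i\<in>I. act (Polynomial.smult c (P v i)) (u i))"
      using P[of v] by (metis (no_types, lifting) act_smult scale_sum_right sum.cong)
    then show "g (c *s v) = c *s g v"
      unfolding g_def[of v] by (simp only: g) (simp add: act_smult scale_sum_right)
  qed
  moreover have "g (f v) = f (g v)" for v
  proof -
    have "f v = (\<Sum>i\<in>I. act (pCons 0 (P v i)) (u i))"
      using arg_cong[OF P[of v], of f] by (simp add: act_pCons f_sum)
    then show ?thesis
      unfolding g_def[of v] by (simp only: g) (simp add: act_pCons f_sum)
  qed
  ultimately have gE: "g \<in> End_f scale f" by (auto simp: End_f_def)
  moreover have "g (u i) = w i" if i: "i \<in> I" for i
  proof -
    have "(\<Sum>j\<in>I. act (if j = i then 1 else 0) (y j)) = (\<Sum>j\<in>I. if j = i then y j else 0)" for y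
      by (rule sum.cong) auto
    then have "(\<Sum>j\<in>I. act (if j = i then 1 else 0) (y j)) = y i" for y
      using I i by simp
    then show ?thesis using g[of "\<lambda>j. if j = i then 1 else 0"] by simp
  qed
  ultimately show thesis by (rule that)
qed

lemma cyclic_decomp_Aut_image:
  assumes dec: "cyclic_decomp UNIV {0} I u t" and a: "\<alpha> \<in> Aut_f scale f"
  shows "cyclic_decomp UNIV {0} I (\<alpha> \<circ> u) t"
proof -
  have E: "\<alpha> \<in> End_f scale f" and bij: "bij \<alpha>" using a by (auto simp: Aut_f_def)
  have eq: "(\<Sum>i\<in>I. act (p i) ((\<alpha> \<circ> u) i)) = \<alpha> (\<Sum>i\<in>I. act (p i) (u i))" for p
    by (simp add: End_f_sum[OF E] act_commute_End[OF E])
  have "\<alpha> v \<in> {0} \<longleftrightarrow> v \<in> {0}" for v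
    using bij End_f_0[OF E] by (metis bij_pointE singleton_iff)
  then have "(\<Sum>i\<in>I. act (p i) ((\<alpha> \<circ> u) i)) \<in> {0} \<longleftrightarrow> (\<forall>i\<in>I. monom 1 (t i) dvd p i)" for p
    unfolding eq using dec unfolding cyclic_decomp_def by blast
  moreover have "\<exists>p. v - (\<Sum>i\<in>I. act (p i) ((\<alpha> \<circ> u) i)) \<in> {0}" for v
  proof -
    obtain v' where v': "v = \<alpha> v'" using bij by (metis bij_pointE)
    obtain p where p: "v' = (\<Sum>i\<in>I. act (p i) (u i))" by (rule cyclic_decomp_repr[OF dec])
    show ?thesis unfolding eq v' using p by auto
  qed
  ultimately show ?thesis unfolding cyclic_decomp_def by simp
qed

text \<open>
  The endomorphisms that send \<open>u\<close> to \<open>u'\<close> and \<open>u'\<close> to \<open>u\<close> are inverse to each other, because a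
  composite that fixes all generators is the identity.
\<close>

lemma Aut_f_of_decomps:
  assumes u: "cyclic_decomp UNIV {0} I u t" and u': "cyclic_decomp UNIV {0} I u' t" and I: "finite I"
  obtains \<alpha> where "\<alpha> \<in> Aut_f scale f" "\<And>i. i \<in> I \<Longrightarrow> \<alpha> (u i) = u' i"
proof -
  have ann: "(f ^^ t i) (y i) = 0" if "cyclic_decomp UNIV {0} I y t" "i \<in> I" for y i
    using cyclic_decomp_single[OF that(1) I that(2), of "monom 1 (t i)"] by (simp add: act_monom)
  obtain g where g: "g \<in> End_f scale f" "\<And>i. i \<in> I \<Longrightarrow> g (u i) = u' i"
    using End_f_extend[OF u ann[OF u'] I] by blast
  obtain h where h: "h \<in> End_f scale f" "\<And>i. i \<in> I \<Longrightarrow> h (u' i) = u i"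
    using End_f_extend[OF u' ann[OF u] I] by blast
  have id: "id \<in> End_f scale f" using linear_id by (simp add: End_f_def id_def o_def)
  have comp: "a \<circ> b \<in> End_f scale f" if "a \<in> End_f scale f" "b \<in> End_f scale f" for a b
    using that Vector_Spaces.linear_compose by (auto simp: End_f_def fun_eq_iff)
  have "h \<circ> g = id"
    by (rule End_f_eqI[OF u comp[OF h(1) g(1)] id]) (simp add: g h)
  moreover have "g \<circ> h = id"
    by (rule End_f_eqI[OF u' comp[OF g(1) h(1)] id]) (simp add: g h)
  ultimately have "bij g" by (rule o_bij)
  then show thesis using that[of g] g by (auto simp: Aut_f_def)
qed

text \<open>
  The inverse of \<open>1 + n\<close> is \<open>1 - n\<close>.
\<close>

lemma transvection_in_Aut_f:
  assumes n: "n \<in> End_f scale f" and nn: "\<And>v. n (n v) = 0"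
  shows "(\<lambda>v. v + n v) \<in> Aut_f scale f"
proof -
  interpret N: Vector_Spaces.linear scale scale n using n by (simp add: End_f_def)
  have "Vector_Spaces.linear scale scale (\<lambda>v. v + n v)"
    by unfold_locales (simp_all add: N.add N.scale scale_right_distrib)
  moreover have "n (f v) = f (n v)" for v using n by (auto simp: End_f_def fun_eq_iff)
  moreover have "bij (\<lambda>v. v + n v)"
    by (rule o_bij[where g = "\<lambda>v. v - n v"]) (auto simp: fun_eq_iff N.add N.diff nn)
  ultimately show ?thesis by (auto simp: Aut_f_def End_f_def f_add)
qed

section \<open>Generator tuples and the subspaces they define\<close>

text \<open>
  Nilpotency makes the exponent of a vector meaningful, and then the exponent determines the
  annihilator of the vector in \<open>K[s]\<close>.
\<close>

lemma generator_tuples_iff: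
  assumes nil: "\<exists>n. \<forall>x. (f ^^ n) x = 0"
  shows "U \<in> generator_tuples scale f t \<longleftrightarrow>
    length U = length t \<and> cyclic_decomp UNIV {0} {..<length t} ((!) U) ((!) t)"
proof (cases "length U = length t")
  case len: True
  let ?I = "{..<length t}"
  have sum_UNIV: "UNIV = (\<Sum>i\<in>?I. cyclic_subspace scale f (U ! i)) \<longleftrightarrow>
      (\<forall>v. \<exists>p. v - (\<Sum>i\<in>?I. act (p i) (U ! i)) \<in> {0})"
  proof -
    have "v \<in> (\<Sum>i\<in>?I. cyclic_subspace scale f (U ! i)) \<longleftrightarrow>
        (\<exists>p. v - (\<Sum>i\<in>?I. act (p i) (U ! i)) \<in> {0})" for v
    proof
      assume "v \<in> (\<Sum>i\<in>?I. cyclic_subspace scale f (U ! i))"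
      then obtain s where s: "v = sum s ?I" "\<forall>i\<in>?I. s i \<in> range (\<lambda>p. act p (U ! i))"
        unfolding set_sum_alt[OF finite_lessThan] cyclic_subspace_eq by blast
      then have "\<forall>i. \<exists>p. i \<in> ?I \<longrightarrow> s i = act p (U ! i)" by blast
      then obtain p where "\<And>i. i \<in> ?I \<longrightarrow> s i = act (p i) (U ! i)" by metis
      then have "v = (\<Sum>i\<in>?I. act (p i) (U ! i))" unfolding s(1) by (intro sum.cong) auto
      then show "\<exists>p. v - (\<Sum>i\<in>?I. act (p i) (U ! i)) \<in> {0}" by auto
    next
      assume "\<exists>p. v - (\<Sum>i\<in>?I. act (p i) (U ! i)) \<in> {0}"
      then obtain p where "v = (\<Sum>i\<in>?I. act (p i) (U ! i))" by auto
      then show "v \<in> (\<Sum>i\<in>?I. cyclic_subspace scale f (U ! i))"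
        unfolding set_sum_alt[OF finite_lessThan] cyclic_subspace_eq
        by (intro CollectI exI[of _ "\<lambda>i. act (p i) (U ! i)"]) auto
    qed
    then show ?thesis by blast
  qed
  have direct: "(\<forall>w. (\<forall>i<length t. w i \<in> cyclic_subspace scale f (U ! i)) \<and> (\<Sum>i<length t. w i) = 0
        \<longrightarrow> (\<forall>i<length t. w i = 0)) \<longleftrightarrow>
      (\<forall>p. (\<Sum>i\<in>?I. act (p i) (U ! i)) = 0 \<longrightarrow> (\<forall>i\<in>?I. act (p i) (U ! i) = 0))" (is "?L \<longleftrightarrow> ?R")
  proof
    assume L: ?L
    show ?R
    proof (intro allI impI)
      fix p assume 0: "(\<Sum>i\<in>?I. act (p i) (U ! i)) = 0"
      from L have "(\<forall>i<length t. act (p i) (U ! i) \<in> cyclic_subspace scale f (U ! i)) \<and>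
          (\<Sum>i<length t. act (p i) (U ! i)) = 0 \<longrightarrow> (\<forall>i<length t. act (p i) (U ! i) = 0)"
        by (rule spec)
      then show "\<forall>i\<in>?I. act (p i) (U ! i) = 0"
        using 0 by (simp add: cyclic_subspace_eq)
    qed
  next
    assume R: ?R
    show ?L
    proof (intro allI impI)
      fix w i
      assume w: "(\<forall>i<length t. w i \<in> cyclic_subspace scale f (U ! i)) \<and> (\<Sum>i<length t. w i) = 0"
        and i: "i < length t"
      have "\<forall>i. \<exists>p. i \<in> ?I \<longrightarrow> w i = act p (U ! i)" using w by (auto simp: cyclic_subspace_eq)
      then obtain p where p: "\<And>i. i \<in> ?I \<longrightarrow> w i = act (p i) (U ! i)" by metis
      have "(\<Sum>i\<in>?I. act (p i) (U ! i)) = (\<Sum>i\<in>?I. w i)" using p by (intro sum.cong) auto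
      then show "w i = 0" using R w p i by auto
    qed
  qed
  have exponent: "exponent f x = e \<longleftrightarrow> (\<forall>p. act p x = 0 \<longleftrightarrow> monom 1 e dvd p)" for x e
  proof
    assume e: "exponent f x = e"
    obtain n where "(f ^^ n) x = 0" using nil by blast
    then have z: "(f ^^ e) x = 0" using e unfolding exponent_def by (metis (mono_tags, lifting) LeastI)
    have nz: "(f ^^ (e - 1)) x \<noteq> 0" if "e > 0"
      using not_less_Least[of "e - 1" "\<lambda>l. (f ^^ l) x = 0"] that e unfolding exponent_def by simp
    show "\<forall>p. act p x = 0 \<longleftrightarrow> monom 1 e dvd p" using act_eq_0_iff[OF nz z] by blast
  next
    assume "\<forall>p. act p x = 0 \<longleftrightarrow> monom 1 e dvd p"
    then have "(f ^^ l) x = 0 \<longleftrightarrow> e \<le> l" for l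
      by (simp add: funpow_eq_act monom_1_dvd_monom_1_iff)
    then show "exponent f x = e" unfolding exponent_def by (auto intro: Least_equality)
  qed
  show ?thesis
  proof
    assume "U \<in> generator_tuples scale f t"
    then have span: "\<forall>v. \<exists>p. v - (\<Sum>i\<in>?I. act (p i) (U ! i)) \<in> {0}"
      and dir: "\<forall>p. (\<Sum>i\<in>?I. act (p i) (U ! i)) = 0 \<longrightarrow> (\<forall>i\<in>?I. act (p i) (U ! i) = 0)"
      and ann: "\<And>i p. i \<in> ?I \<Longrightarrow> act p (U ! i) = 0 \<longleftrightarrow> monom 1 (t ! i) dvd p"
      unfolding generator_tuples_def is_direct_sum_def by (auto simp only: len sum_UNIV direct exponent mem_Collect_eq lessThan_iff)
    have "(\<Sum>i\<in>?I. act (p i) (U ! i)) \<in> {0} \<longleftrightarrow> (\<forall>i\<in>?I. monom 1 (t ! i) dvd p i)" for p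
    proof
      assume "(\<Sum>i\<in>?I. act (p i) (U ! i)) \<in> {0}"
      then show "\<forall>i\<in>?I. monom 1 (t ! i) dvd p i" using dir ann by (metis singletonD)
    next
      assume "\<forall>i\<in>?I. monom 1 (t ! i) dvd p i"
      then show "(\<Sum>i\<in>?I. act (p i) (U ! i)) \<in> {0}" using ann by (auto intro!: sum.neutral)
    qed
    then show "length U = length t \<and> cyclic_decomp UNIV {0} ?I ((!) U) ((!) t)"
      using len span unfolding cyclic_decomp_def by simp
  next
    assume "length U = length t \<and> cyclic_decomp UNIV {0} ?I ((!) U) ((!) t)"
    then have dec: "cyclic_decomp UNIV {0} ?I ((!) U) ((!) t)" by simp
    have ann: "act p (U ! i) = 0 \<longleftrightarrow> monom 1 (t ! i) dvd p" if "i < length t" for i p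
      using cyclic_decomp_single[OF dec] that by simp
    then have "\<forall>i<length t. exponent f (U ! i) = t ! i" using exponent by blast
    moreover have "\<forall>v. \<exists>p. v - (\<Sum>i\<in>?I. act (p i) (U ! i)) \<in> {0}"
      using dec unfolding cyclic_decomp_def by blast
    moreover have "\<forall>i\<in>?I. act (p i) (U ! i) = 0" if "(\<Sum>i\<in>?I. act (p i) (U ! i)) = 0" for p
    proof -
      have "(\<Sum>i\<in>?I. act (p i) (U ! i)) \<in> {0} \<longleftrightarrow> (\<forall>i\<in>?I. monom 1 (t ! i) dvd p i)"
        using dec unfolding cyclic_decomp_def by blast
      then show ?thesis using ann that by simp
    qed
    ultimately show "U \<in> generator_tuples scale f t"
      unfolding generator_tuples_def is_direct_sum_def
      by (simp only: len sum_UNIV direct mem_Collect_eq) blast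
  qed
qed (simp add: generator_tuples_def)

lemma W_gen_eq:
  "W_gen scale f r U =
     {\<Sum>i<length U. act (p i) (U ! i) | p. \<forall>i<length U. monom 1 (r ! i) dvd p i}"
proof (intro equalityI subsetI)
  fix v assume "v \<in> W_gen scale f r U"
  then obtain s where s: "v = (\<Sum>i<length U. s i)"
    and mem: "\<forall>i\<in>{..<length U}. s i \<in> range (\<lambda>q. act q ((f ^^ (r ! i)) (U ! i)))"
    unfolding W_gen_def set_sum_alt[OF finite_lessThan] cyclic_subspace_eq by blast
  have "\<forall>i. \<exists>q. i < length U \<longrightarrow> s i = act q ((f ^^ (r ! i)) (U ! i))" using mem by blast
  then obtain q where "\<And>i. i < length U \<longrightarrow> s i = act (q i) ((f ^^ (r ! i)) (U ! i))" by metis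
  then have "v = (\<Sum>i<length U. act (q i * monom 1 (r ! i)) (U ! i))"
    unfolding s by (intro sum.cong) (auto simp: act_mult act_monom)
  moreover have "\<forall>i<length U. monom 1 (r ! i) dvd q i * monom 1 (r ! i)" by simp
  ultimately show "v \<in> {\<Sum>i<length U. act (p i) (U ! i) | p. \<forall>i<length U. monom 1 (r ! i) dvd p i}"
    by (intro CollectI exI conjI)
next
  fix v assume "v \<in> {\<Sum>i<length U. act (p i) (U ! i) | p. \<forall>i<length U. monom 1 (r ! i) dvd p i}"
  then obtain p where v: "v = (\<Sum>i<length U. act (p i) (U ! i))"
    and p: "\<forall>i<length U. monom 1 (r ! i) dvd p i" by blast
  have "act (p i) (U ! i) \<in> range (\<lambda>q. act q ((f ^^ (r ! i)) (U ! i)))" if i: "i < length U" for i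
  proof -
    obtain q where "p i = q * monom 1 (r ! i)" using p i by (metis dvd_def mult.commute)
    then have "act (p i) (U ! i) = act q ((f ^^ (r ! i)) (U ! i))"
      by (simp add: act_mult act_monom)
    then show ?thesis by simp
  qed
  then show "v \<in> W_gen scale f r U"
    unfolding W_gen_def set_sum_alt[OF finite_lessThan] cyclic_subspace_eq v
    by (intro CollectI exI[of _ "\<lambda>i. act (p i) (U ! i)"]) auto
qed

lemma subspace_W_gen: "subspace (W_gen scale f r U)"
  and f_W_gen: "f ` W_gen scale f r U \<subseteq> W_gen scale f r U"
proof -
  let ?v = "\<lambda>p. \<Sum>i<length U. act (p i) (U ! i)"
  let ?ok = "\<lambda>p :: nat \<Rightarrow> 'k poly. \<forall>i<length U. monom 1 (r ! i) dvd p i"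
  have intro: "v \<in> W_gen scale f r U" if "?ok p" "v = ?v p" for v p
    unfolding W_gen_eq using that by blast
  have elim: "\<exists>p. ?ok p \<and> v = ?v p" if "v \<in> W_gen scale f r U" for v
    using that unfolding W_gen_eq by blast
  show "subspace (W_gen scale f r U)"
  proof (rule subspaceI)
    show "0 \<in> W_gen scale f r U" by (rule intro[of "\<lambda>_. 0"]) auto
    fix v assume "v \<in> W_gen scale f r U"
    from elim[OF this] obtain p where p: "?ok p" "v = ?v p" by blast
    show "c *s v \<in> W_gen scale f r U" for c
      by (rule intro[of "\<lambda>i. Polynomial.smult c (p i)"])
        (use p in \<open>auto simp: act_smult scale_sum_right dvd_smult\<close>)
    fix w assume "w \<in> W_gen scale f r U"
    from elim[OF this] obtain q where q: "?ok q" "w = ?v q" by blast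
    show "v + w \<in> W_gen scale f r U"
      by (rule intro[of "\<lambda>i. p i + q i"]) (use p q in \<open>auto simp: act_add sum.distrib\<close>)
  qed
  show "f ` W_gen scale f r U \<subseteq> W_gen scale f r U"
  proof (rule image_subsetI)
    fix v assume "v \<in> W_gen scale f r U"
    from elim[OF this] obtain p where p: "?ok p" "v = ?v p" by blast
    show "f v \<in> W_gen scale f r U"
      by (rule intro[of "\<lambda>i. [:0, 1:] * p i"])
        (use p in \<open>auto simp: act_pCons f_sum simp del: mult_pCons_left intro!: sum.cong simp: act_mult\<close>)
  qed
qed

end

locale generator_family = linear_endomorphism scale f
  for scale :: "'k::field \<Rightarrow> 'v::ab_group_add \<Rightarrow> 'v" (infixr "*s" 75) and f +
  fixes t :: "nat list" and U :: "'v list" and k :: nat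
  assumes nilpotent: "\<exists>n. \<forall>x. (f ^^ n) x = 0"
    and U: "U \<in> generator_tuples scale f t"
  defines "k \<equiv> length t"
begin

lemma length_U: "length U = k"
  using U by (simp add: generator_tuples_def k_def)

lemma decomp: "cyclic_decomp UNIV {0} {..<k} ((!) U) ((!) t)"
  using U generator_tuples_iff[OF nilpotent] by (simp add: k_def)

lemma repr:
  obtains p where "v = (\<Sum>i<k. act (p i) (U ! i))"
  using cyclic_decomp_repr[OF decomp] by blast

lemma sum_act_eq_0_iff:
  "(\<Sum>i<k. act (p i) (U ! i)) = 0 \<longleftrightarrow> (\<forall>i<k. monom 1 (t ! i) dvd p i)"
proof -
  have "(\<Sum>i<k. act (p i) (U ! i)) \<in> {0} \<longleftrightarrow> (\<forall>i\<in>{..<k}. monom 1 (t ! i) dvd p i)"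
    using decomp unfolding cyclic_decomp_def by blast
  then show ?thesis by auto
qed

lemma act_U_eq_0_iff: "i < k \<Longrightarrow> act p (U ! i) = 0 \<longleftrightarrow> monom 1 (t ! i) dvd p"
  using cyclic_decomp_single[OF decomp] by simp

text \<open>
  Membership in \<open>W(r, U)\<close> is decided coordinatewise by divisibility.  The coordinates \<open>p i\<close> of a vector
  are only determined modulo \<open>s\<^bsup>t i\<^esup>\<close>, but admissibility gives \<open>r i \<le> t i\<close>, so the condition does not
  depend on the choice of the \<open>p i\<close>.
\<close>

lemma sum_act_in_W_gen_iff:
  assumes "admissible t r"
  shows "(\<Sum>i<k. act (p i) (U ! i)) \<in> W_gen scale f r U \<longleftrightarrow> (\<forall>i<k. monom 1 (r ! i) dvd p i)"
proof
  assume "(\<Sum>i<k. act (p i) (U ! i)) \<in> W_gen scale f r U"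
  then obtain q where q: "\<forall>i<k. monom 1 (r ! i) dvd q i"
    and eq: "(\<Sum>i<k. act (p i) (U ! i)) = (\<Sum>i<k. act (q i) (U ! i))"
    unfolding W_gen_eq length_U by blast
  have "(\<Sum>i<k. act (p i - q i) (U ! i)) = 0"
    using eq by (simp add: act_diff sum_subtractf)
  then have t: "\<forall>i<k. monom 1 (t ! i) dvd p i - q i" by (simp only: sum_act_eq_0_iff)
  show "\<forall>i<k. monom 1 (r ! i) dvd p i"
  proof (intro allI impI)
    fix i assume i: "i < k"
    have "monom (1::'k) (r ! i) dvd monom 1 (t ! i)"
      using assms i by (simp add: admissible_def k_def monom_1_dvd_monom_1_iff)
    then have "monom 1 (r ! i) dvd (p i - q i) + q i"
      using t q i dvd_trans by (intro dvd_add) blast+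
    then show "monom 1 (r ! i) dvd p i" by simp
  qed
next
  assume "\<forall>i<k. monom 1 (r ! i) dvd p i"
  then show "(\<Sum>i<k. act (p i) (U ! i)) \<in> W_gen scale f r U"
    unfolding W_gen_eq length_U by blast
qed

lemma decomp_mod_W_gen:
  assumes "admissible t r"
  shows "cyclic_decomp UNIV (W_gen scale f r U) {..<k} ((!) U) ((!) r)"
proof -
  have "\<exists>p. v - (\<Sum>i<k. act (p i) (U ! i)) \<in> W_gen scale f r U" for v
  proof -
    obtain p where "v = (\<Sum>i<k. act (p i) (U ! i))" by (rule repr)
    then have "v - (\<Sum>i<k. act (p i) (U ! i)) \<in> W_gen scale f r U"
      using subspace_0[OF subspace_W_gen] by simp
    then show ?thesis by blast
  qed
  then show ?thesis
    unfolding cyclic_decomp_def using sum_act_in_W_gen_iff[OF assms] by (simp add: Ball_def)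
qed

lemma act_U_in_W_gen_iff:
  assumes "admissible t r" "i < k"
  shows "act p (U ! i) \<in> W_gen scale f r U \<longleftrightarrow> monom 1 (r ! i) dvd p"
  using cyclic_decomp_single[OF decomp_mod_W_gen[OF assms(1)]] assms(2) by simp

text \<open>
  The generators \<open>f\<^bsup>r i\<^esup> u\<^sub>i\<close> of \<open>W(r, U)\<close> have exponents \<open>t i - r i\<close>, because \<open>s\<^bsup>t i\<^esup>\<close> divides \<open>s\<^bsup>r i\<^esup> p\<close>
  iff \<open>s\<^bsup>t i - r i\<^esup>\<close> divides \<open>p\<close>.
\<close>

lemma decomp_W_gen:
  assumes adm: "admissible t r"
  shows "cyclic_decomp (W_gen scale f r U) {0} {..<k}
    (\<lambda>i. (f ^^ (r ! i)) (U ! i)) ((!) (map2 (-) t r))"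
proof -
  have nth: "map2 (-) t r ! i = t ! i - r ! i" if "i < k" for i
    using that adm by (simp add: admissible_def k_def)
  have act: "act p ((f ^^ n) x) = act (monom 1 n * p) x" for p n x
    by (metis act_monom act_mult mult.commute scale_one)
  have "(\<Sum>i<k. act (p i) ((f ^^ (r ! i)) (U ! i))) \<in> {0} \<longleftrightarrow>
      (\<forall>i\<in>{..<k}. monom 1 (map2 (-) t r ! i) dvd p i)" for p
    unfolding act using sum_act_eq_0_iff[of "\<lambda>i. monom 1 (r ! i) * p i"]
    by (auto simp: monom_1_dvd_monom_1_mult_iff nth)
  moreover have "\<exists>p. v - (\<Sum>i<k. act (p i) ((f ^^ (r ! i)) (U ! i))) \<in> {0}"
    if "v \<in> W_gen scale f r U" for v
  proof -
    obtain p where p: "v = (\<Sum>i<k. act (p i) (U ! i))" by (rule repr)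
    have "\<forall>i<k. monom 1 (r ! i) dvd p i"
      using that sum_act_in_W_gen_iff[OF adm] unfolding p by blast
    then have "\<forall>i. \<exists>q. i < k \<longrightarrow> p i = monom 1 (r ! i) * q" by (metis dvd_def)
    then obtain q where q: "\<And>i. i < k \<longrightarrow> p i = monom 1 (r ! i) * q i" by metis
    have "v = (\<Sum>i<k. act (q i) ((f ^^ (r ! i)) (U ! i)))"
      unfolding p act by (intro sum.cong) (simp_all add: q)
    then show ?thesis by auto
  qed
  moreover have "(f ^^ (r ! i)) (U ! i) \<in> W_gen scale f r U" if "i < k" for i
    unfolding funpow_eq_act using act_U_in_W_gen_iff[OF adm that] by simp
  ultimately show ?thesis unfolding cyclic_decomp_def by simp
qed

section \<open>Invariance under automorphisms and endomorphisms\<close>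

lemma generator_tuples_eq_Aut_orbit:
  "generator_tuples scale f t = (\<lambda>\<alpha>. map \<alpha> U) ` Aut_f scale f"
proof (intro equalityI subsetI)
  fix U' assume "U' \<in> generator_tuples scale f t"
  then have len: "length U' = k" and dec: "cyclic_decomp UNIV {0} {..<k} ((!) U') ((!) t)"
    using generator_tuples_iff[OF nilpotent] by (auto simp: k_def)
  obtain \<alpha> where \<alpha>: "\<alpha> \<in> Aut_f scale f" "\<And>i. i \<in> {..<k} \<Longrightarrow> \<alpha> (U ! i) = U' ! i"
    by (rule Aut_f_of_decomps[OF decomp dec]) auto
  have "U' = map \<alpha> U" using len length_U \<alpha>(2) by (intro nth_equalityI) auto
  then show "U' \<in> (\<lambda>\<alpha>. map \<alpha> U) ` Aut_f scale f" using \<alpha>(1) by blast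
next
  fix U' assume "U' \<in> (\<lambda>\<alpha>. map \<alpha> U) ` Aut_f scale f"
  then obtain \<alpha> where \<alpha>: "\<alpha> \<in> Aut_f scale f" and U': "U' = map \<alpha> U" by blast
  have "cyclic_decomp UNIV {0} {..<k} ((!) U') ((!) t)"
    using cyclic_decomp_Aut_image[OF decomp \<alpha>] length_U
    unfolding cyclic_decomp_def U' by simp
  then show "U' \<in> generator_tuples scale f t"
    using generator_tuples_iff[OF nilpotent] length_U U' by (simp add: k_def)
qed

lemma W_gen_map:
  assumes "g \<in> End_f scale f"
  shows "W_gen scale f r (map g U) = g ` W_gen scale f r U"
proof -
  have "(\<Sum>i<k. act (p i) (map g U ! i)) = g (\<Sum>i<k. act (p i) (U ! i))" for p
    unfolding End_f_sum[OF assms] act_commute_End[OF assms]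
    by (intro sum.cong) (simp_all add: length_U)
  then show ?thesis unfolding W_gen_eq by (auto simp: length_U)
qed

text \<open>
  The generator tuples form one orbit under the automorphisms, and an automorphism \<open>\<alpha>\<close> maps \<open>W(r, U)\<close>
  to \<open>W(r, \<alpha> U)\<close>.
\<close>

lemma characteristic_iff_independent:
  "characteristic scale f (W_gen scale f r U) \<longleftrightarrow>
     (\<forall>U' \<in> generator_tuples scale f t. W_gen scale f r U = W_gen scale f r U')"
proof -
  have "W_gen scale f r (map \<alpha> U) = \<alpha> ` W_gen scale f r U" if "\<alpha> \<in> Aut_f scale f" for \<alpha>
    using that by (intro W_gen_map) (simp add: Aut_f_def)
  then have "(\<forall>U' \<in> generator_tuples scale f t. W_gen scale f r U = W_gen scale f r U') \<longleftrightarrow>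
      (\<forall>\<alpha> \<in> Aut_f scale f. W_gen scale f r U = \<alpha> ` W_gen scale f r U)"
    unfolding generator_tuples_eq_Aut_orbit by simp
  then show ?thesis
    using subspace_W_gen[of r U] f_W_gen[of r U] unfolding characteristic_def by metis
qed

text \<open>
  The automorphism used here is the transvection that sends \<open>u\<^sub>i\<close> to \<open>u\<^sub>i + f\<^sup>n u\<^sub>j\<close> and fixes the other
  generators; it exists since \<open>f\<^bsup>t i\<^esup>\<close> kills \<open>f\<^sup>n u\<^sub>j\<close>.  Applied to \<open>f\<^bsup>r i\<^esup> u\<^sub>i\<close>, it shows that
  \<open>f\<^bsup>r i + n\<^esup> u\<^sub>j\<close> is in \<open>W(r, U)\<close>.  Because the
  automorphisms are unipotent, the argument works over every field, including the field with two
  elements.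
\<close>

lemma characteristic_imp_le:
  assumes char: "characteristic scale f (W_gen scale f r U)" and adm: "admissible t r"
    and ij: "i < k" "j < k" "i \<noteq> j" and n: "t ! j \<le> t ! i + n"
  shows "r ! j \<le> r ! i + n"
proof -
  let ?w = "\<lambda>l. if l = i then act (monom 1 n) (U ! j) else 0"
  have "(f ^^ (t ! i)) (act (monom 1 n) (U ! j)) = 0"
    using act_U_eq_0_iff[OF ij(2), of "monom 1 (t ! i) * monom 1 n"] n
    unfolding funpow_eq_act by (simp add: mult_monom monom_1_dvd_monom_1_iff flip: act_mult)
  then have "(f ^^ (t ! l)) (?w l) = 0" for l by simp
  then obtain h where h: "h \<in> End_f scale f" and hw: "\<And>l. l \<in> {..<k} \<Longrightarrow> h (U ! l) = ?w l"
    using End_f_extend[OF decomp, of ?w] by blast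
  \<comment> \<open>The map \<open>h\<close> sends everything into the cyclic subspace of \<open>u\<^sub>j\<close>, on which it vanishes as \<open>i \<noteq> j\<close>.\<close>
  have "h (h v) = 0" for v
  proof -
    obtain p where v: "v = (\<Sum>l<k. act (p l) (U ! l))" by (rule repr)
    have "h (h (U ! l)) = 0" if "l < k" for l
      using that hw[of l] hw[of j] ij by (simp add: act_commute_End[OF h] End_f_0[OF h])
    then show ?thesis unfolding v by (simp add: End_f_sum[OF h] act_commute_End[OF h])
  qed
  then have \<alpha>: "(\<lambda>v. v + h v) \<in> Aut_f scale f" by (rule transvection_in_Aut_f[OF h])
  have fU: "(f ^^ (r ! i)) (U ! i) \<in> W_gen scale f r U"
    unfolding funpow_eq_act using act_U_in_W_gen_iff[OF adm ij(1)] by simp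
  then have "(f ^^ (r ! i)) (U ! i) + h ((f ^^ (r ! i)) (U ! i)) \<in> W_gen scale f r U"
    using char \<alpha> unfolding characteristic_def by blast
  from subspace_diff[OF subspace_W_gen this fU]
  have "h ((f ^^ (r ! i)) (U ! i)) \<in> W_gen scale f r U" by simp
  also have "h ((f ^^ (r ! i)) (U ! i)) = act (monom 1 (r ! i) * monom 1 n) (U ! j)"
    using hw[of i] ij by (simp add: act_commute_End[OF h] funpow_eq_act act_mult)
  finally show ?thesis
    using act_U_in_W_gen_iff[OF adm ij(2)] by (simp add: mult_monom monom_1_dvd_monom_1_iff)
qed

text \<open>
  For \<open>i < j\<close>, the transvection that adds \<open>u\<^sub>i\<close> to \<open>u\<^sub>j\<close> yields \<open>r i \<le> r j\<close>, and the one that adds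
  \<open>f\<^bsup>t j - t i\<^esup> u\<^sub>j\<close> to \<open>u\<^sub>i\<close> yields \<open>t i - r i \<le> t j - r j\<close>.
\<close>

lemma characteristic_imp_sorted:
  assumes char: "characteristic scale f (W_gen scale f r U)" and adm: "admissible t r"
    and t: "sorted t"
  shows "sorted r \<and> sorted (map2 (-) t r)"
proof -
  have len: "length t = k" "length r = k" using adm by (auto simp: admissible_def k_def)
  have le: "r ! i \<le> r ! j \<and> r ! j \<le> r ! i + (t ! j - t ! i)" "t ! i \<le> t ! j"
    if "i < j" "j < k" for i j
    using characteristic_imp_le[OF char adm, of i j "t ! j - t ! i"]
      characteristic_imp_le[OF char adm, of j i 0] that t len
    by (auto simp: sorted_wrt_nth_less)
  have "r ! i \<le> t ! i" if "i < k" for i using adm that by (simp add: admissible_def k_def)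
  then have "t ! i - r ! i \<le> t ! j - r ! j" if "i < j" "j < k" for i j
    using le[OF that] that by linarith
  then show ?thesis using le len by (auto simp: sorted_wrt_iff_nth_less)
qed

lemma W_gen_subset_W_can:
  assumes adm: "admissible t r"
  shows "W_gen scale f r U \<subseteq> W_can f t r"
proof
  fix v assume vW: "v \<in> W_gen scale f r U"
  obtain p where v: "v = (\<Sum>i<k. act (p i) (U ! i))" by (rule repr)
  have p: "\<forall>i<k. monom 1 (r ! i) dvd p i" using vW unfolding v sum_act_in_W_gen_iff[OF adm] .
  have "act (p i) (U ! i) \<in> range (f ^^ (r ! i)) \<inter> {x. (f ^^ (t ! i - r ! i)) x = 0}" if i: "i < k" for i
  proof -
    obtain q where q: "p i = monom 1 (r ! i) * q" using p i by (metis dvd_def)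
    have "act (p i) (U ! i) = (f ^^ (r ! i)) (act q (U ! i))"
      unfolding q by (simp add: act_mult act_monom)
    moreover have "r ! i \<le> t ! i" using adm i by (simp add: admissible_def k_def)
    then have "(f ^^ (t ! i - r ! i)) (act (p i) (U ! i)) = 0"
      using act_U_eq_0_iff[OF i, of "monom 1 (t ! i - r ! i) * p i"]
      unfolding q funpow_eq_act by (simp add: mult_monom flip: act_mult mult.assoc)
    ultimately show ?thesis by blast
  qed
  then show "v \<in> W_can f t r"
    unfolding W_can_def set_sum_alt[OF finite_lessThan] v k_def[symmetric]
    by (intro CollectI exI[of _ "\<lambda>i. act (p i) (U ! i)"]) simp
qed

text \<open>
  Let \<open>x\<close> be in the \<open>i\<close>-th summand of \<open>W(r)\<close>.  Its \<open>j\<close>-th coordinate is divisible by \<open>s\<^bsup>r i\<^esup>\<close>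
  because \<open>x\<close> is in the image of \<open>f\<^bsup>r i\<^esup>\<close>, which suffices for \<open>j \<le> i\<close> as \<open>r\<close> is sorted.  For
  \<open>j > i\<close> the kernel condition takes over: it gives divisibility by
  \<open>s\<^bsup>t j - (t i - r i)\<^esup>\<close>, and \<open>t j - (t i - r i) \<ge> r j\<close> as \<open>t - r\<close> is sorted.
\<close>

lemma W_can_subset_W_gen:
  assumes adm: "admissible t r" and r: "sorted r" and tr: "sorted (map2 (-) t r)"
  shows "W_can f t r \<subseteq> W_gen scale f r U"
proof -
  have len: "length t = k" "length r = k" using adm by (auto simp: admissible_def k_def)
  have summand: "x \<in> W_gen scale f r U"
    if i: "i < k" and x: "x \<in> range (f ^^ (r ! i))" "(f ^^ (t ! i - r ! i)) x = 0" for i x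
  proof -
    obtain y where y: "x = (f ^^ (r ! i)) y" using x(1) by blast
    obtain q where q: "y = (\<Sum>j<k. act (q j) (U ! j))" by (rule repr)
    have xq: "x = (\<Sum>j<k. act (monom 1 (r ! i) * q j) (U ! j))"
      unfolding y q funpow_eq_act by (simp add: act_vec_sum act_mult)
    have ri: "r ! i \<le> t ! i" using adm i by (simp add: admissible_def k_def)
    have "(\<Sum>j<k. act (monom 1 (t ! i) * q j) (U ! j)) = (f ^^ (t ! i - r ! i)) x"
      unfolding xq funpow_eq_act using ri
      by (simp add: act_vec_sum mult_monom flip: act_mult mult.assoc)
    then have ker: "monom 1 (t ! j) dvd monom 1 (t ! i) * q j" if "j < k" for j
      using that x(2) sum_act_eq_0_iff by simp
    have "monom 1 (r ! j) dvd monom 1 (r ! i) * q j" if j: "j < k" for j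
    proof (cases "j \<le> i")
      case True
      then have "r ! j \<le> r ! i" using r i len by (simp add: sorted_nth_mono)
      then show ?thesis by (simp add: monom_1_dvd_monom_1_mult_iff)
    next
      case False
      then have "map2 (-) t r ! i \<le> map2 (-) t r ! j" using j len by (intro sorted_nth_mono[OF tr]) auto
      then have "t ! i - r ! i \<le> t ! j - r ! j" using i j len by simp
      moreover have "r ! j \<le> t ! j" using adm j by (simp add: admissible_def k_def)
      ultimately have "r ! j - r ! i \<le> t ! j - t ! i" using ri by linarith
      then have "monom (1::'k) (r ! j - r ! i) dvd monom 1 (t ! j - t ! i)"
        by (simp add: monom_1_dvd_monom_1_iff)
      then show ?thesis using ker[OF j] by (metis dvd_trans monom_1_dvd_monom_1_mult_iff)
    qed
    then show ?thesis unfolding xq sum_act_in_W_gen_iff[OF adm] by blast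
  qed
  show ?thesis
  proof
    fix v assume "v \<in> W_can f t r"
    then obtain s where v: "v = (\<Sum>i<k. s i)"
      and s: "\<forall>i\<in>{..<k}. s i \<in> range (f ^^ (r ! i)) \<inter> {x. (f ^^ (t ! i - r ! i)) x = 0}"
      unfolding W_can_def set_sum_alt[OF finite_lessThan] k_def by blast
    show "v \<in> W_gen scale f r U"
      unfolding v by (rule subspace_sum[OF subspace_W_gen]) (use s summand in auto)
  qed
qed

lemma End_f_W_can:
  assumes g: "g \<in> End_f scale f"
  shows "g ` W_can f t r \<subseteq> W_can f t r"
proof (rule image_subsetI)
  fix v assume "v \<in> W_can f t r"
  then obtain s where v: "v = (\<Sum>i<k. s i)"
    and s: "\<forall>i\<in>{..<k}. s i \<in> range (f ^^ (r ! i)) \<inter> {x. (f ^^ (t ! i - r ! i)) x = 0}"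
    unfolding W_can_def set_sum_alt[OF finite_lessThan] k_def by blast
  have "g (s i) \<in> range (f ^^ (r ! i)) \<inter> {x. (f ^^ (t ! i - r ! i)) x = 0}" if i: "i < k" for i
  proof -
    obtain y where y: "s i = (f ^^ (r ! i)) y" and ker: "(f ^^ (t ! i - r ! i)) (s i) = 0"
      using bspec[OF s, of i] i by auto
    have "(f ^^ (t ! i - r ! i)) (g (s i)) = g 0"
      unfolding ker[symmetric] by (simp add: End_f_funpow[OF g])
    then show ?thesis using y by (simp add: End_f_0[OF g] End_f_funpow[OF g])
  qed
  then show "g v \<in> W_can f t r"
    unfolding W_can_def set_sum_alt[OF finite_lessThan] v k_def[symmetric] End_f_sum[OF g]
    by (intro CollectI exI[of _ "\<lambda>i. g (s i)"]) simp
qed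

end

context linear_endomorphism
begin

lemma hyperinvariant_imp_characteristic:
  assumes hyp: "hyperinvariant scale f X"
  shows "characteristic scale f X"
proof -
  have "\<alpha> ` X = X" if a: "\<alpha> \<in> Aut_f scale f" for \<alpha>
  proof -
    have E: "\<alpha> \<in> End_f scale f" and bij: "bij \<alpha>" using a by (auto simp: Aut_f_def)
    interpret A: Vector_Spaces.linear scale scale \<alpha> using E by (simp add: End_f_def)
    let ?\<beta> = "inv_into UNIV \<alpha>"
    have inv: "\<alpha> (?\<beta> v) = v" "?\<beta> (\<alpha> v) = v" for v
      using bij by (simp_all add: bij_is_surj surj_f_inv_f bij_is_inj)
    have "Vector_Spaces.linear scale scale ?\<beta>"
    proof
      show "?\<beta> (v + w) = ?\<beta> v + ?\<beta> w" for v w by (metis A.add inv)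
      show "?\<beta> (c *s v) = c *s ?\<beta> v" for c v by (metis A.scale inv)
    qed
    moreover have "?\<beta> (f v) = f (?\<beta> v)" for v
      using E inv unfolding End_f_def by (metis (mono_tags, lifting) comp_apply mem_Collect_eq)
    ultimately have "?\<beta> \<in> End_f scale f" by (auto simp: End_f_def)
    then have "?\<beta> ` X \<subseteq> X" "\<alpha> ` X \<subseteq> X" using hyp E by (auto simp: hyperinvariant_def)
    then show ?thesis using inv by (metis image_subset_iff subsetI subset_antisym image_eqI)
  qed
  moreover have "f \<in> End_f scale f" using linear_f by (simp add: End_f_def)
  ultimately show ?thesis using hyp by (auto simp: hyperinvariant_def characteristic_def)
qed

end

section \<open>Elementary divisors\<close>

text \<open>
  A subspace and a quotient space are both of the form \<open>S/N\<close> for invariant subspaces of \<open>V\<close>.  The map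
  \<open>\<pi>\<close> is the projection of \<open>S\<close> onto the module \<open>M\<close>, total on \<open>V\<close>; pulling back along \<open>\<pi>\<close> turns
  decompositions of \<open>M\<close> into decompositions of \<open>S\<close> modulo \<open>N\<close>.
\<close>

locale module_presentation = linear_endomorphism scale f
  for scale :: "'k::field \<Rightarrow> 'v::ab_group_add \<Rightarrow> 'v" (infixr "*s" 75) and f +
  fixes M :: "('k, 'm) module" and g :: "'m \<Rightarrow> 'm" and \<pi> :: "'v \<Rightarrow> 'm" and S N :: "'v set"
  assumes S: "subspace S" "f ` S \<subseteq> S"
    and M: "abelian_monoid M"
    and carrier: "carrier M = \<pi> ` S"
    and proj_zero: "\<pi> 0 = \<zero>\<^bsub>M\<^esub>"
    and proj_add: "\<pi> (x + y) = \<pi> x \<oplus>\<^bsub>M\<^esub> \<pi> y"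
    and proj_scale: "\<pi> (c *s x) = c \<odot>\<^bsub>M\<^esub> \<pi> x"
    and proj_f: "\<pi> (f x) = g (\<pi> x)"
    and proj_eq: "\<pi> x = \<pi> y \<longleftrightarrow> x - y \<in> N"
begin

lemma proj_eq_zero: "\<pi> x = \<zero>\<^bsub>M\<^esub> \<longleftrightarrow> x \<in> N"
  using proj_eq[of x 0] by (simp add: proj_zero)

lemma proj_funpow: "(g ^^ n) (\<pi> x) = \<pi> ((f ^^ n) x)"
  by (induction n) (simp_all add: proj_f)

lemma finsum_proj:
  assumes "finite A" "\<And>a. a \<in> A \<Longrightarrow> h a \<in> S"
  shows "finsum M (\<lambda>a. \<pi> (h a)) A = \<pi> (sum h A)"
proof -
  interpret M: abelian_monoid M by (rule M)
  show ?thesis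
    using assms
    by (induction A) (auto simp: proj_zero proj_add carrier M.finsum_insert)
qed

lemma poly_act_proj:
  assumes "x \<in> S"
  shows "poly_act M g p (\<pi> x) = \<pi> (act p x)"
proof -
  have "coeff p a *s (f ^^ a) x \<in> S" for a
    unfolding funpow_eq_act by (intro subspace_scale act_closed S assms)
  then show ?thesis
    unfolding poly_act_def act_def proj_funpow proj_scale[symmetric]
    by (intro finsum_proj) auto
qed

lemma finsum_poly_act_proj:
  assumes "finite A" "\<And>a. a \<in> A \<Longrightarrow> x a \<in> S"
  shows "finsum M (\<lambda>a. poly_act M g (p a) (\<pi> (x a))) A = \<pi> (\<Sum>a\<in>A. act (p a) (x a))"
proof -
  interpret M: abelian_monoid M by (rule M)
  have "finsum M (\<lambda>a. poly_act M g (p a) (\<pi> (x a))) A = finsum M (\<lambda>a. \<pi> (act (p a) (x a))) A"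
    by (rule M.finsum_cong') (use assms act_closed[OF S] in \<open>auto simp: poly_act_proj carrier\<close>)
  also have "\<dots> = \<pi> (\<Sum>a\<in>A. act (p a) (x a))"
    by (rule finsum_proj) (use assms act_closed[OF S] in auto)
  finally show ?thesis .
qed

lemma has_elementary_divisors_if_cyclic_decomp:
  assumes dec: "cyclic_decomp S N {..<length ns} x ((!) ns)" and N: "subspace N"
  shows "has_elementary_divisors M g (s_powers ns)"
proof -
  let ?is = "filter (\<lambda>i. 0 < ns ! i) [0..<length ns]"
  let ?n = "length ?is"
  define y where "y = x \<circ> (!) ?is"
  define e where "e = (!) ns \<circ> (!) ?is"
  define xs where "xs = map (\<pi> \<circ> y) [0..<?n]"
  define ds :: "'k poly list" where "ds = map (\<lambda>j. monom 1 (e j)) [0..<?n]"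
  have "bij_betw ((!) ?is) {..<?n} {i \<in> {..<length ns}. 0 < ns ! i}"
    using bij_betw_nth[of ?is "{..<?n}" "set ?is"] by (auto simp: lessThan_def conj_commute)
  with cyclic_decomp_restrict[OF dec _ N] have "cyclic_decomp S N {..<?n} y e"
    unfolding y_def e_def by (intro cyclic_decomp_reindex) auto
  then have yS: "\<And>j. j < ?n \<Longrightarrow> y j \<in> S"
    and span: "\<And>v. v \<in> S \<Longrightarrow> \<exists>p. v - (\<Sum>j<?n. act (p j) (y j)) \<in> N"
    and sum: "\<And>p. (\<Sum>j<?n. act (p j) (y j)) \<in> N \<longleftrightarrow> (\<forall>j<?n. monom 1 (e j) dvd p j)"
    and single: "\<And>p j. j < ?n \<Longrightarrow> act p (y j) \<in> N \<longleftrightarrow> monom 1 (e j) dvd p"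
    using cyclic_decomp_single[of S N "{..<?n}" y e] unfolding cyclic_decomp_def by auto
  have len: "length xs = ?n" "length ds = ?n" by (simp_all add: xs_def ds_def)
  have nth: "xs ! j = \<pi> (y j)" "ds ! j = monom 1 (e j)" if "j < ?n" for j
    using that by (simp_all add: xs_def ds_def)
  have epos: "0 < e j" if "j < ?n" for j
    using nth_mem[OF that] by (simp add: e_def)
  have finsum: "finsum M (\<lambda>j. poly_act M g (p j) (xs ! j)) {..<?n} = \<pi> (\<Sum>j<?n. act (p j) (y j))" for p
  proof -
    interpret M: abelian_monoid M by (rule M)
    have "finsum M (\<lambda>j. poly_act M g (p j) (xs ! j)) {..<?n}
        = finsum M (\<lambda>j. poly_act M g (p j) (\<pi> (y j))) {..<?n}"
      by (rule M.finsum_cong') (use yS nth act_closed[OF S] in \<open>auto simp: poly_act_proj carrier\<close>)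
    also have "\<dots> = \<pi> (\<Sum>j<?n. act (p j) (y j))"
      by (rule finsum_poly_act_proj) (use yS in auto)
    finally show ?thesis .
  qed
  have "mset ds = s_powers ns"
  proof -
    have "ds = map (monom 1) (map ((!) ns) ?is)"
      by (rule nth_equalityI) (simp_all add: ds_def e_def)
    also have "map ((!) ns) ?is = filter (\<lambda>n. 0 < n) ns"
      using filter_map[of "\<lambda>n. 0 < n" "(!) ns" "[0..<length ns]"] by (simp add: map_nth o_def)
    finally show ?thesis by (simp add: s_powers_def)
  qed
  moreover have "set xs \<subseteq> carrier M" using yS by (auto simp: xs_def carrier)
  moreover have "\<exists>q a. irreducible q \<and> lead_coeff q = 1 \<and> 0 < a \<and> d = q ^ a" if d: "d \<in> set ds" for d
  proof -
    obtain j where j: "j < ?n" "d = monom 1 (e j)" using d by (auto simp: ds_def)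
    have "irreducible [:0, 1 :: 'k:]" by (rule irreducible_linear_field_poly) simp
    moreover have "d = [:0, 1:] ^ e j" by (simp add: j monom_altdef)
    ultimately show ?thesis using epos[OF j(1)] by (intro exI[of _ "[:0, 1:]"] exI[of _ "e j"]) simp
  qed
  moreover have "poly_act M g p (xs ! j) = \<zero>\<^bsub>M\<^esub> \<longleftrightarrow> ds ! j dvd p" if "j < ?n" for j p
    using that by (simp add: nth poly_act_proj yS proj_eq_zero single)
  moreover have "\<exists>p. v = finsum M (\<lambda>j. poly_act M g (p j) (xs ! j)) {..<?n}" if v: "v \<in> carrier M" for v
  proof -
    obtain w where w: "w \<in> S" "v = \<pi> w" using v by (auto simp: carrier)
    obtain p where "w - (\<Sum>j<?n. act (p j) (y j)) \<in> N" using span[OF w(1)] by blast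
    then show ?thesis unfolding finsum w(2) proj_eq by blast
  qed
  moreover have "poly_act M g (p j) (xs ! j) = \<zero>\<^bsub>M\<^esub>"
    if "finsum M (\<lambda>j. poly_act M g (p j) (xs ! j)) {..<?n} = \<zero>\<^bsub>M\<^esub>" "j < ?n" for p j
    using that unfolding finsum proj_eq_zero sum
    by (simp add: nth poly_act_proj yS proj_eq_zero single)
  ultimately show ?thesis
    unfolding has_elementary_divisors_def
    by (intro exI[of _ xs] exI[of _ ds]) (simp only: len, blast)
qed

lemma cyclic_decomp_if_has_elementary_divisors:
  assumes "has_elementary_divisors M g (s_powers ns)"
  obtains x :: "nat \<Rightarrow> 'v" and es where "cyclic_decomp S N {..<length es} x ((!) es)"
    "mset es = filter_mset (\<lambda>n. 0 < n) (mset ns)"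
proof -
  obtain xs ds where len: "length xs = length ds" and ds: "mset ds = s_powers ns"
    and xs: "set xs \<subseteq> carrier M"
    and single_all: "\<forall>i<length xs. \<forall>p. poly_act M g p (xs ! i) = \<zero>\<^bsub>M\<^esub> \<longleftrightarrow> ds ! i dvd p"
    and span: "\<forall>v \<in> carrier M. \<exists>p. v = finsum M (\<lambda>i. poly_act M g (p i) (xs ! i)) {..<length xs}"
    and direct: "\<forall>p. finsum M (\<lambda>i. poly_act M g (p i) (xs ! i)) {..<length xs} = \<zero>\<^bsub>M\<^esub> \<longrightarrow>
        (\<forall>i<length xs. poly_act M g (p i) (xs ! i) = \<zero>\<^bsub>M\<^esub>)"
    using assms unfolding has_elementary_divisors_def by (elim exE conjE) (rule that)
  have single: "poly_act M g p (xs ! i) = \<zero>\<^bsub>M\<^esub> \<longleftrightarrow> ds ! i dvd p" if "i < length xs" for i p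
    using single_all that by blast
  let ?n = "length xs"
  define es where "es = map degree ds"
  have ds_nth: "ds ! i = monom 1 (es ! i)" if "i < ?n" for i
  proof -
    have "ds ! i \<in> set ds" using that len by simp
    then have "ds ! i \<in># s_powers ns" unfolding ds[symmetric] by simp
    then obtain n where "ds ! i = monom 1 n" by (auto simp: s_powers_def)
    then show ?thesis using that len by (simp add: es_def degree_monom_eq)
  qed
  have "mset es = image_mset degree (s_powers ns :: 'k poly multiset)"
    by (simp add: es_def ds[symmetric])
  also have "\<dots> = filter_mset (\<lambda>n. 0 < n) (mset ns)"
    by (simp add: s_powers_def multiset.map_comp o_def degree_monom_eq)
  finally have mset: "mset es = filter_mset (\<lambda>n. 0 < n) (mset ns)" .
  have "\<forall>i. \<exists>y. i < ?n \<longrightarrow> y \<in> S \<and> xs ! i = \<pi> y"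
    using xs unfolding carrier by (metis image_iff nth_mem subset_iff)
  then obtain x where x: "\<And>i. i < ?n \<Longrightarrow> x i \<in> S" "\<And>i. i < ?n \<Longrightarrow> xs ! i = \<pi> (x i)"
    by metis
  have finsum: "finsum M (\<lambda>j. poly_act M g (p j) (xs ! j)) {..<?n} = \<pi> (\<Sum>j<?n. act (p j) (x j))" for p
  proof -
    interpret M: abelian_monoid M by (rule M)
    have "finsum M (\<lambda>j. poly_act M g (p j) (xs ! j)) {..<?n}
        = finsum M (\<lambda>j. poly_act M g (p j) (\<pi> (x j))) {..<?n}"
      by (rule M.finsum_cong') (use x act_closed[OF S] in \<open>auto simp: poly_act_proj carrier\<close>)
    also have "\<dots> = \<pi> (\<Sum>j<?n. act (p j) (x j))"
      by (rule finsum_poly_act_proj) (use x in auto)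
    finally show ?thesis .
  qed
  have "(\<Sum>j<?n. act (p j) (x j)) \<in> N \<longleftrightarrow> (\<forall>i<?n. monom 1 (es ! i) dvd p i)" for p
  proof
    assume "(\<Sum>j<?n. act (p j) (x j)) \<in> N"
    then have "finsum M (\<lambda>j. poly_act M g (p j) (xs ! j)) {..<?n} = \<zero>\<^bsub>M\<^esub>"
      by (simp only: finsum proj_eq_zero)
    then show "\<forall>i<?n. monom 1 (es ! i) dvd p i" using direct single ds_nth by auto
  next
    interpret M: abelian_monoid M by (rule M)
    assume "\<forall>i<?n. monom 1 (es ! i) dvd p i"
    then have "finsum M (\<lambda>j. poly_act M g (p j) (xs ! j)) {..<?n} = finsum M (\<lambda>_. \<zero>\<^bsub>M\<^esub>) {..<?n}"
      by (intro M.finsum_cong') (auto simp: single ds_nth)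
    then show "(\<Sum>j<?n. act (p j) (x j)) \<in> N" by (simp add: finsum proj_eq_zero)
  qed
  moreover have "\<exists>p. v - (\<Sum>j<?n. act (p j) (x j)) \<in> N" if "v \<in> S" for v
    using bspec[OF span, of "\<pi> v"] that unfolding finsum proj_eq by (auto simp: carrier)
  ultimately have "cyclic_decomp S N {..<length es} x ((!) es)"
    using x(1) len by (auto simp: cyclic_decomp_def es_def Ball_def)
  then show thesis using mset that by blast
qed

end

context linear_endomorphism
begin

lemma presentation_sub_space:
  assumes "subspace W" "f ` W \<subseteq> W"
  shows "module_presentation scale f (sub_space scale W) f id W {0}"
proof (intro module_presentation.intro[OF linear_endomorphism_axioms] module_presentation_axioms.intro)
  show "abelian_monoid (sub_space scale W)"
    by (intro abelian_monoid.intro comm_monoidI)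
      (auto simp: sub_space_def subspace_0 subspace_add assms add_ac)
qed (use assms in \<open>auto simp: sub_space_def\<close>)

lemma presentation_quotient_space:
  assumes W: "subspace W" "f ` W \<subseteq> W"
  shows "module_presentation scale f (quotient_space scale W) (quotient_map f W) (\<lambda>v. v +o W) UNIV W"
proof (intro module_presentation.intro[OF linear_endomorphism_axioms] module_presentation_axioms.intro)
  have W0: "0 \<in> W" using W(1) by (rule subspace_0)
  have WW: "W + W = W"
    using W0 subspace_add[OF W(1)] by (auto simp: set_plus_def) (metis add.left_neutral)
  have coset_add: "(x + y) +o W = (x +o W) + (y +o W)" for x y
    by (simp add: set_plus_rearrange WW)
  \<comment> \<open>The set \<open>h ` W\<close> may be smaller than \<open>W\<close>, for example if \<open>h = 0\<close>; adding \<open>W\<close> fills up the coset.\<close>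
  have coset_image: "h ` (x +o W) + W = h x +o W"
    if "h ` W \<subseteq> W" "\<And>a b. h (a + b) = h a + h b" for h :: "'v \<Rightarrow> 'v" and x
  proof -
    have "h ` (x +o W) = h x +o h ` W" by (force simp: elt_set_plus_def that(2))
    moreover have "h ` W + W = W"
    proof
      show "h ` W + W \<subseteq> W" using that(1) WW set_plus_mono2 by blast
      have "0 \<in> h ` W" using that(2)[of 0 0] W0 by (metis add_cancel_right_left image_eqI)
      then show "W \<subseteq> h ` W + W" by (rule set_zero_plus2)
    qed
    ultimately show ?thesis by (simp add: set_plus_rearrange3)
  qed
  show "0 +o W = \<zero>\<^bsub>quotient_space scale W\<^esub>"
    by (simp add: quotient_space_def)
  show "(x + y) +o W = (x +o W) \<oplus>\<^bsub>quotient_space scale W\<^esub> (y +o W)" for x y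
    by (simp add: quotient_space_def coset_add)
  show "(c *s x) +o W = c \<odot>\<^bsub>quotient_space scale W\<^esub> (x +o W)" for c x
    using coset_image[of "scale c" x] subspace_scale[OF W(1)]
    by (auto simp: quotient_space_def scale_right_distrib)
  show "f x +o W = quotient_map f W (x +o W)" for x
    unfolding quotient_map_def using coset_image[of f x] W(2) by (simp add: f_add)
  show "x +o W = y +o W \<longleftrightarrow> x - y \<in> W" for x y
  proof
    assume "x +o W = y +o W"
    moreover have "x \<in> x +o W" using W0 by (auto simp: elt_set_plus_def)
    ultimately show "x - y \<in> W" by (auto simp: elt_set_plus_def)
  next
    assume xy: "x - y \<in> W"
    have "(x - y) +o W = W"
    proof
      show "(x - y) +o W \<subseteq> W" using subspace_add[OF W(1) xy] by (auto simp: elt_set_plus_def)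
      show "W \<subseteq> (x - y) +o W"
      proof
        fix w assume "w \<in> W"
        then have "w - (x - y) \<in> W" using xy by (rule subspace_diff[OF W(1)])
        then show "w \<in> (x - y) +o W" unfolding elt_set_plus_def by force
      qed
    qed
    then have "y +o ((x - y) +o W) = y +o W" by simp
    then show "x +o W = y +o W" by (simp add: set_plus_rearrange2)
  qed
  show "abelian_monoid (quotient_space scale W)"
  proof (intro abelian_monoid.intro comm_monoidI)
    show "a \<otimes>\<^bsub>add_monoid (quotient_space scale W)\<^esub> b \<in> carrier (add_monoid (quotient_space scale W))"
      if "a \<in> carrier (add_monoid (quotient_space scale W))"
        "b \<in> carrier (add_monoid (quotient_space scale W))" for a b
      using that by (auto simp: quotient_space_def simp flip: coset_add)
    show "\<one>\<^bsub>add_monoid (quotient_space scale W)\<^esub> \<in> carrier (add_monoid (quotient_space scale W))"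
      by (auto simp: quotient_space_def intro: range_eqI[of _ _ 0])
    show "\<one>\<^bsub>add_monoid (quotient_space scale W)\<^esub> \<otimes>\<^bsub>add_monoid (quotient_space scale W)\<^esub> a = a"
      if a: "a \<in> carrier (add_monoid (quotient_space scale W))" for a
    proof -
      obtain x where "a = x +o W" using a by (auto simp: quotient_space_def)
      then show ?thesis using coset_add[of 0 x] by (simp add: quotient_space_def)
    qed
  qed (simp_all add: quotient_space_def add_ac)
  show "carrier (quotient_space scale W) = range (\<lambda>v. v +o W)" by (simp add: quotient_space_def)
qed (use assms in auto)

end

section \<open>Multisets and sorted lists of exponents\<close>

lemma sum_mset_diff_Suc:
  fixes A :: "nat multiset"
  shows "(\<Sum>n\<in>#A. n - j) = (\<Sum>n\<in>#A. n - Suc j) + size (filter_mset (\<lambda>n. j < n) A)"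
  by (induction A) auto

lemma size_filter_less_Suc:
  fixes A :: "nat multiset"
  shows "size (filter_mset (\<lambda>n. j < n) A) = size (filter_mset (\<lambda>n. Suc j < n) A) + count A (Suc j)"
  by (induction A) auto

text \<open>
  The number of entries equal to \<open>j + 1\<close> is a second difference in \<open>j\<close> of the sum of the truncated
  differences \<open>n - j\<close>, which does not see the entries \<open>0\<close>.
\<close>

lemma filter_mset_eqI_sum_diff:
  fixes A B :: "nat multiset"
  assumes "\<And>j. (\<Sum>n\<in>#A. n - j) = (\<Sum>n\<in>#B. n - j)"
  shows "filter_mset (\<lambda>n. 0 < n) A = filter_mset (\<lambda>n. 0 < n) B"
proof (rule multiset_eqI)
  fix n
  have size: "size (filter_mset (\<lambda>n. j < n) A) = size (filter_mset (\<lambda>n. j < n) B)" for j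
    using sum_mset_diff_Suc[where A = A and j = j] sum_mset_diff_Suc[where A = B and j = j] assms[of j] assms[of "Suc j"] by linarith
  show "count (filter_mset (\<lambda>n. 0 < n) A) n = count (filter_mset (\<lambda>n. 0 < n) B) n"
  proof (cases n)
    case (Suc j)
    then show ?thesis
      using size_filter_less_Suc[where A = A and j = j] size_filter_less_Suc[where A = B and j = j] size[of j] size[of "Suc j"] by simp
  qed simp
qed

lemma mset_eqI_filter_pos:
  fixes xs ys :: "nat list"
  assumes len: "length xs = length ys"
    and pos: "filter_mset (\<lambda>n. 0 < n) (mset xs) = filter_mset (\<lambda>n. 0 < n) (mset ys)"
  shows "mset xs = mset ys"
proof -
  have split: "mset zs = filter_mset (\<lambda>n. 0 < n) (mset zs) + replicate_mset (count (mset zs) 0) 0" for zs :: "nat list"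
    by (rule multiset_eqI) (auto simp: gr0_conv_Suc)
  have "size (mset xs) = size (mset ys)" using len by simp
  then have "count (mset xs) 0 = count (mset ys) 0"
    using pos split[of xs] split[of ys] by (metis add_left_cancel size_replicate_mset size_union)
  then show ?thesis using split[of xs] split[of ys] pos by simp
qed

text \<open>
  The last entry of \<open>r\<close> is the largest of \<open>r\<close>, so that of \<open>r'\<close> is at most as large; the same holds for
  the last entries of \<open>t - r\<close> and \<open>t - r'\<close>.  As the two last entries of \<open>r\<close> and \<open>t - r\<close> add up to that
  of \<open>t\<close>, and likewise for \<open>r'\<close>, they agree, and they can be removed.
\<close>

lemma eq_if_sorted_and_differences_sorted:
  fixes t r r' :: "nat list"
  assumes "length r = length t" "length r' = length t"
    and "\<forall>i<length t. r ! i \<le> t ! i" "\<forall>i<length t. r' ! i \<le> t ! i"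
    and "sorted r" "sorted (map2 (-) t r)"
    and "mset r' = mset r" "mset (map2 (-) t r') = mset (map2 (-) t r)"
  shows "r' = r"
  using assms
proof (induction t arbitrary: r r' rule: rev_induct)
  case Nil
  then show ?case by simp
next
  case (snoc a t)
  obtain s b where r: "r = s @ [b]" "length s = length t"
    using snoc.prems(1) by (cases r rule: rev_cases) auto
  obtain s' b' where r': "r' = s' @ [b']" "length s' = length t"
    using snoc.prems(2) by (cases r' rule: rev_cases) auto
  have b: "b \<le> a" "b' \<le> a"
    using snoc.prems(3,4)[rule_format, of "length t"] r r' by (auto simp: nth_append)
  have "b' \<in># mset r" unfolding snoc.prems(7)[symmetric] by (simp add: r')
  then have "b' \<le> b" using snoc.prems(5) by (auto simp: r sorted_append)
  have "a - b' \<in># mset (map2 (-) (t @ [a]) r)" unfolding snoc.prems(8)[symmetric] by (simp add: r')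
  then have "a - b' \<le> a - b" using snoc.prems(6) r(2) by (auto simp: r sorted_append)
  with \<open>b' \<le> b\<close> b have eq: "b' = b" by linarith
  have "s' = s"
  proof (rule snoc.IH)
    show "\<forall>i<length t. s ! i \<le> t ! i" "\<forall>i<length t. s' ! i \<le> t ! i"
      using snoc.prems(3,4) r r' by (auto simp: nth_append less_Suc_eq)
  qed (use snoc.prems r r' eq in \<open>auto simp: sorted_append\<close>)
  then show ?case using r r' eq by simp
qed

section \<open>Uniqueness among marked subspaces\<close>

context fin_dim_endomorphism
begin

text \<open>
  Both decompositions compute the dimensions of the spaces \<open>f\<^sup>j S + N\<close>, so they have the same positive
  exponents.  Equal lengths then force equal numbers of zeros.
\<close>

lemma elementary_divisors_unique:
  assumes pres: "module_presentation scale f M g \<pi> S N"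
    and N: "subspace N" "f ` N \<subseteq> N" "N \<subseteq> S"
    and dec: "cyclic_decomp S N {..<length ms} x ((!) ms)"
    and div: "has_elementary_divisors M g (s_powers ns)" and len: "length ms = length ns"
  shows "mset ms = mset ns"
proof -
  interpret P: module_presentation scale f M g \<pi> S N by (rule pres)
  obtain y es where y: "cyclic_decomp S N {..<length es} y ((!) es)"
    and es: "mset es = filter_mset (\<lambda>n. 0 < n) (mset ns)"
    using P.cyclic_decomp_if_has_elementary_divisors[OF div] by blast
  have dim: "dim (N \<union> (f ^^ j) ` S) = dim N + (\<Sum>n\<in>#mset ls. n - j)"
    if "cyclic_decomp S N {..<length ls} z ((!) ls)" for j z ls
    using dim_image_cyclic_decomp[OF that finite_lessThan P.S N]
    by (simp add: sum_list_sum_nth atLeast0LessThan sum_mset_sum_list flip: mset_map)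
  have "filter_mset (\<lambda>n. 0 < n) (mset ms) = filter_mset (\<lambda>n. 0 < n) (mset es)"
    using dim[OF dec] dim[OF y] by (intro filter_mset_eqI_sum_diff) (metis add_left_cancel)
  also have "\<dots> = filter_mset (\<lambda>n. 0 < n) (mset ns)" by (simp add: es filter_filter_mset)
  finally show ?thesis by (rule mset_eqI_filter_pos[OF len])
qed

end

locale fin_dim_generator_family =
  generator_family scale f t U k + fin_dim_endomorphism scale f Basis
  for scale :: "'k::field \<Rightarrow> 'v::ab_group_add \<Rightarrow> 'v" (infixr "*s" 75) and f t U k Basis
begin

lemma has_divisor_lists_W_gen:
  assumes adm: "admissible t r"
  shows "has_divisor_lists scale f t r (W_gen scale f r U)"
proof -
  have len: "length (map2 (-) t r) = k" "length r = k" using adm by (auto simp: admissible_def k_def)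
  interpret sub: module_presentation scale f "sub_space scale (W_gen scale f r U)" f id "W_gen scale f r U" "{0}"
    by (intro presentation_sub_space subspace_W_gen f_W_gen)
  interpret quot: module_presentation scale f "quotient_space scale (W_gen scale f r U)"
      "quotient_map f (W_gen scale f r U)" "\<lambda>v. v +o W_gen scale f r U" UNIV "W_gen scale f r U"
    by (intro presentation_quotient_space subspace_W_gen f_W_gen)
  show ?thesis
    unfolding has_divisor_lists_def
    using sub.has_elementary_divisors_if_cyclic_decomp[of "map2 (-) t r"] decomp_W_gen[OF adm]
      quot.has_elementary_divisors_if_cyclic_decomp[of r] decomp_mod_W_gen[OF adm]
      subspace_single_0 subspace_W_gen
    by (simp only: len)
qed

lemma mset_eq_if_has_divisor_lists_W_gen:
  assumes adm: "admissible t r" "admissible t r'"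
    and div: "has_divisor_lists scale f t r (W_gen scale f r' U)"
  shows "mset r' = mset r" "mset (map2 (-) t r') = mset (map2 (-) t r)"
proof -
  let ?W = "W_gen scale f r' U"
  have len: "length (map2 (-) t r') = k" "length (map2 (-) t r) = k" "length r' = k" "length r = k"
    using adm by (auto simp: admissible_def k_def)
  note W = subspace_W_gen[of r' U] f_W_gen[of r' U]
  show "mset r' = mset r"
    by (rule elementary_divisors_unique[OF presentation_quotient_space[OF W]])
      (use W div decomp_mod_W_gen[OF adm(2)] in \<open>auto simp: len has_divisor_lists_def\<close>)
  show "mset (map2 (-) t r') = mset (map2 (-) t r)"
    by (rule elementary_divisors_unique[OF presentation_sub_space[OF W]])
      (use W div decomp_W_gen[OF adm(2)] in \<open>auto simp only: len has_divisor_lists_def, auto simp: subspace_0\<close>)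
qed

text \<open>
  A marked subspace \<open>W(r', U')\<close> with the given divisors has \<open>r'\<close> and \<open>t - r'\<close> equal to \<open>r\<close> and \<open>t - r\<close>
  up to order, which forces \<open>r' = r\<close>; and \<open>W(r, U') = W(r)\<close> for every generator tuple \<open>U'\<close>.
\<close>

lemma unique_marked_if_sorted:
  assumes adm: "admissible t r" and r: "sorted r" "sorted (map2 (-) t r)"
    and W: "marked scale f t W" "has_divisor_lists scale f t r W"
  shows "W = W_can f t r"
proof -
  obtain U' r' where U': "U' \<in> generator_tuples scale f t" and adm': "admissible t r'"
    and WU: "W = W_gen scale f r' U'" using W(1) by (auto simp: marked_def)
  interpret U': fin_dim_generator_family scale f t U' k Basis
    by unfold_locales (use nilpotent U' in \<open>auto simp: k_def\<close>)
  have "r' = r"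
    by (rule eq_if_sorted_and_differences_sorted[of r t r'])
      (use adm adm' r U'.mset_eq_if_has_divisor_lists_W_gen[OF adm adm'] W(2)
        in \<open>auto simp: admissible_def WU\<close>)
  then show ?thesis
    unfolding WU using U'.W_gen_subset_W_can[OF adm] U'.W_can_subset_W_gen[OF adm r] by blast
qed

end

section \<open>Equivalence of the six conditions\<close>

theorem theorem3p1:
  fixes scale :: "'k::field \<Rightarrow> 'v::ab_group_add \<Rightarrow> 'v"
    and B :: "'v set"
    and f :: "'v \<Rightarrow> 'v"
    and t r :: "nat list"
    and U :: "'v list"
  assumes "finite_dimensional_vector_space scale B"
    and "Vector_Spaces.linear scale scale f"
    and "\<exists>n. \<forall>x. (f ^^ n) x = 0"
    and "sorted t" and "\<forall>i<length t. 0 < t ! i"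
    and "has_elementary_divisors (sub_space scale UNIV) f (s_powers t)"
    and "U \<in> generator_tuples scale f t"
    and "admissible t r"
  defines "i \<equiv> characteristic scale f (W_gen scale f r U)"
    and "ii \<equiv> (\<forall>U' \<in> generator_tuples scale f t. W_gen scale f r U = W_gen scale f r U')"
    and "iii \<equiv> sorted r \<and> sorted (map2 (-) t r)"
    and "iv \<equiv> W_gen scale f r U = W_can f t r"
    and "v \<equiv>
      (marked scale f t (W_gen scale f r U) \<and> has_divisor_lists scale f t r (W_gen scale f r U)) \<and>
      (\<forall>W. marked scale f t W \<and> has_divisor_lists scale f t r W \<longrightarrow> W = W_gen scale f r U)"
    and "vi \<equiv> hyperinvariant scale f (W_gen scale f r U)"
  shows "(i \<longleftrightarrow> ii) \<and> (ii \<longleftrightarrow> iii) \<and> (iii \<longleftrightarrow> iv) \<and> (iv \<longleftrightarrow> v) \<and> (v \<longleftrightarrow> vi)"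
proof -
  interpret fin_dim_generator_family scale f t U "length t" B
    using assms(1-3,7)
    by (auto simp: fin_dim_generator_family_def fin_dim_endomorphism_def generator_family_def
        generator_family_axioms_def linear_endomorphism_def linear_endomorphism_axioms_def
        finite_dimensional_vector_space_def)
  have marked: "marked scale f t (W_gen scale f r U')" if "U' \<in> generator_tuples scale f t" for U'
    using that assms(8) by (auto simp: marked_def)
  have divisors: "has_divisor_lists scale f t r (W_gen scale f r U')"
    if U': "U' \<in> generator_tuples scale f t" for U'
  proof -
    interpret U': fin_dim_generator_family scale f t U' "length t" B
      by unfold_locales (use assms(3) U' in auto)
    show ?thesis by (rule U'.has_divisor_lists_W_gen[OF assms(8)])
  qed
  have "i \<longleftrightarrow> ii"
    unfolding i_def ii_def by (rule characteristic_iff_independent)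
  moreover have "i \<Longrightarrow> iii"
    unfolding i_def iii_def using characteristic_imp_sorted assms(4,8) by blast
  moreover have "iii \<Longrightarrow> iv"
    unfolding iii_def iv_def using W_gen_subset_W_can W_can_subset_W_gen assms(8) by blast
  moreover have "iv \<Longrightarrow> vi"
    unfolding iv_def vi_def hyperinvariant_def using subspace_W_gen[of r U] End_f_W_can by simp
  moreover have "vi \<Longrightarrow> i"
    unfolding vi_def i_def by (rule hyperinvariant_imp_characteristic)
  moreover have "iii \<Longrightarrow> v"
    unfolding iii_def v_def
    using marked[OF assms(7)] divisors[OF assms(7)] unique_marked_if_sorted[OF assms(8)] by blast
  \<comment> \<open>Each \<open>W(r, U')\<close> is a marked subspace with the prescribed divisors, so uniqueness identifies them.\<close>
  moreover have "v \<Longrightarrow> ii"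
    unfolding v_def ii_def using marked divisors by metis
  ultimately show ?thesis by blast
qed

end
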